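(* There is an algorithm that computes the chromatic number of any $n$-vertex graph $G$ in time $O\bigl((4/3+3^{4/3}/4)^n\bigr)$ (approximately $O(2.4150^n)$) and space $O(2^n)$.
   Context: The chromatic number $\chi(G)$ is the minimum number of colors in an assignment of colors to the vertices of $G$ such that adjacent vertices receive different colors. The model of computation is the unit-cost RAM: a single memory cell can hold an integer large enough to index the program's memory (in particular $n$-bit integers), and arithmetic and array-indexing operations on such values take constant time. *)

theory Defs
  imports Complex_Main "HOL-Library.Landau_Symbols"
begin

section \<open>Graphs and the chromatic number\<close>

definition simple_graph :: "'a set \<Rightarrow> 'a set set \<Rightarrow> bool" where
  "simple_graph V E \<longleftrightarrow> finite V \<and> E \<subseteq> {{u, v} | u v. u \<in> V \<and> v \<in> V \<and> u \<noteq> v}"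

definition proper_coloring :: "'a set set \<Rightarrow> ('a \<Rightarrow> nat) \<Rightarrow> bool" where
  "proper_coloring E c \<longleftrightarrow> (\<forall>u v. {u, v} \<in> E \<longrightarrow> c u \<noteq> c v)"

definition chromatic_number :: "'a set \<Rightarrow> 'a set set \<Rightarrow> nat" where
  "chromatic_number V E = (LEAST k. \<exists>c. proper_coloring E c \<and> card (c ` V) = k)"


section \<open>The unit-cost RAM\<close>

text \<open>
  A single memory of cells addressed by natural numbers; the operands of an instruction are
  addresses, except for the constant of \<open>Const\<close> and the targets of jumps, which are positions
  in the program. The destination comes first.
\<close>

datatype instr =
    Const nat nat
  | Move nat nat
  | Load nat nat
  | Store nat nat
  | Add nat nat nat
  | Sub nat nat nat
  | Mult nat nat nat
  | Div nat nat nat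
  | Jump nat
  | JumpZero nat nat

type_synonym program = "instr list"
type_synonym memory = "nat \<Rightarrow> nat"
type_synonym config = "nat \<times> memory"

text \<open>
  Subtraction is truncated at 0, and division rounds down, with \<open>x div 0 = 0\<close>.
\<close>

fun exec :: "instr \<Rightarrow> config \<Rightarrow> config" where
  "exec (Const a k) (pc, m) = (pc + 1, m(a := k))"
| "exec (Move a b) (pc, m) = (pc + 1, m(a := m b))"
| "exec (Load a b) (pc, m) = (pc + 1, m(a := m (m b)))"
| "exec (Store a b) (pc, m) = (pc + 1, m(m a := m b))"
| "exec (Add a b c) (pc, m) = (pc + 1, m(a := m b + m c))"
| "exec (Sub a b c) (pc, m) = (pc + 1, m(a := m b - m c))"
| "exec (Mult a b c) (pc, m) = (pc + 1, m(a := m b * m c))"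
| "exec (Div a b c) (pc, m) = (pc + 1, m(a := m b div m c))"
| "exec (Jump l) (pc, m) = (l, m)"
| "exec (JumpZero a l) (pc, m) = (if m a = 0 then l else pc + 1, m)"

fun accessed :: "instr \<Rightarrow> memory \<Rightarrow> nat set" where
  "accessed (Const a k) m = {a}"
| "accessed (Move a b) m = {a, b}"
| "accessed (Load a b) m = {a, b, m b}"
| "accessed (Store a b) m = {a, b, m a}"
| "accessed (Add a b c) m = {a, b, c}"
| "accessed (Sub a b c) m = {a, b, c}"
| "accessed (Mult a b c) m = {a, b, c}"
| "accessed (Div a b c) m = {a, b, c}"
| "accessed (Jump l) m = {}"
| "accessed (JumpZero a l) m = {a}"

text \<open>The machine halts when the program counter leaves the program.\<close>

definition halted :: "program \<Rightarrow> config \<Rightarrow> bool" where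
  "halted P s \<longleftrightarrow> length P \<le> fst s"

definition step :: "program \<Rightarrow> config \<Rightarrow> config" where
  "step P s = (if halted P s then s else exec (P ! fst s) s)"

definition initial_config :: "nat list \<Rightarrow> config" where
  "initial_config xs = (0, \<lambda>a. if a < length xs then xs ! a else 0)"

definition run :: "program \<Rightarrow> nat list \<Rightarrow> nat \<Rightarrow> config" where
  "run P xs t = (step P ^^ t) (initial_config xs)"

text \<open>
  On input \<open>xs\<close>, the program halts after at most \<open>T\<close> instructions with the result \<open>y\<close> in cell 0,
  on a machine whose memory consists of the cells \<open>0, \<dots>, M - 1\<close> (input included), each of
  which holds \<open>w\<close>-bit nonnegative integers. \<open>exec\<close> itself does not truncate values; the last
  conjunct says that no value ever exceeds the word length, so that the truncation is immaterial.
\<close>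

definition computes_within :: "program \<Rightarrow> nat list \<Rightarrow> nat \<Rightarrow> nat \<Rightarrow> nat \<Rightarrow> nat \<Rightarrow> bool" where
  "computes_within P xs y T M w \<longleftrightarrow>
     (\<exists>t \<le> T.
        halted P (run P xs t) \<and>
        snd (run P xs t) 0 = y \<and>
        length xs \<le> M \<and>
        (\<forall>i<t. \<not> halted P (run P xs i) \<longrightarrow>
           accessed (P ! fst (run P xs i)) (snd (run P xs i)) \<subseteq> {..<M}) \<and>
        (\<forall>i\<le>t. \<forall>a. snd (run P xs i) a < 2 ^ w))"

text \<open>
  A graph on the vertices \<open>0, \<dots>, n - 1\<close> is given as \<open>n\<close> followed by its adjacency matrix,
  row by row.
\<close>

definition graph_input :: "nat \<Rightarrow> nat set set \<Rightarrow> nat list" where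
  "graph_input n E = n # map (\<lambda>i. if {i div n, i mod n} \<in> E then 1 else 0) [0..<n * n]"

end

theory Submission
  imports Defs "HOL-Library.Nat_Bijection" "HOL-Real_Asymp.Real_Asymp"
begin

text \<open>
  By inclusion-exclusion, the number of ways to cover the vertex set by \<open>k\<close> independent sets is,
  up to sign, the sum of \<open>(-1) ^ card S * i(S) ^ k\<close> over all vertex sets \<open>S\<close>, where \<open>i(S)\<close> is the number
  of independent subsets of \<open>S\<close>; the chromatic number is the least \<open>k\<close> for which it is nonzero.
  All the \<open>i(S)\<close> are found in time \<open>O(n * 2 ^ n)\<close>, by \<open>i(S \<union> {v}) = i(S) + i(S - N(v))\<close>. The sum may have
  \<open>n\<^sup>2\<close> bits and does not fit into a word, but it is at most \<open>2 ^ (n * n)\<close> in absolute value, which is less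
  than the least common multiple of all \<open>m \<le> 2 * n * n + 2\<close>. So it is zero as soon as it is divisible
  by all these \<open>m\<close>, and its residues modulo such small numbers are easy to compute.
  The total time is \<open>2 ^ n\<close> times a polynomial, and \<open>2 < 25 / 12 \<le> 4 / 3 + 3 powr (4 / 3) / 4\<close>.
\<close>

section \<open>Covers by independent sets\<close>

text \<open>Covers are lists of independent sets that may overlap, repeat or be empty. This makes
  the lists inside \<open>S\<close> number exactly \<open>i(S) ^ k\<close>, and keeps the count
  positive for every \<open>k\<close> from the chromatic number on. The bound on the least common
  multiple needs no estimate on primes: a common multiple of \<open>1, ..., 2 * m\<close> is already
  a multiple of \<open>m * (2 * m choose m)\<close>, which is at least \<open>4 ^ m / 2\<close>. The
  moduli are quadratic in \<open>n\<close>, so products of two residues fit into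
  \<open>n + d\<close> bits for a constant \<open>d\<close>. Running through all moduli and all
  \<open>k\<close> multiplies the work by a polynomial only, which is affordable because the target
  base is strictly above 2. The machine model adds two obstacles: the input lies in the very cells
  that instructions can address statically, and every intermediate value must be shown to fit into a
  word. Hence the program logic carries time, address and word bounds together.\<close>

definition indep :: "'a set set \<Rightarrow> 'a set \<Rightarrow> bool" where
  "indep E J \<longleftrightarrow> (\<forall>u\<in>J. \<forall>v\<in>J. {u, v} \<notin> E)"

definition num_indep :: "'a set set \<Rightarrow> 'a set \<Rightarrow> nat" where
  "num_indep E S = card {J. J \<subseteq> S \<and> indep E J}"

text \<open>Lists without any disjointness condition: only then are the \<open>k\<close> members
  chosen independently of each other.\<close>

definition num_covers :: "'a set set \<Rightarrow> nat \<Rightarrow> 'a set \<Rightarrow> nat" where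
  "num_covers E k S = card {Js. length Js = k \<and> set Js \<subseteq> Collect (indep E) \<and> \<Union>(set Js) = S}"

lemma finite_covers:
  assumes "finite S"
  shows "finite {Js. length Js = k \<and> set Js \<subseteq> Collect (indep E) \<and> \<Union>(set Js) = S}"
proof (rule finite_subset)
  show "{Js. length Js = k \<and> set Js \<subseteq> Collect (indep E) \<and> \<Union>(set Js) = S}
          \<subseteq> {Js. set Js \<subseteq> Pow S \<and> length Js = k}"
    by auto
  show "finite {Js. set Js \<subseteq> Pow S \<and> length Js = k}"
    using assms by (intro finite_lists_length_eq) simp
qed

text \<open>The lists of \<open>k\<close> independent subsets of \<open>S\<close> are sorted by
  their union. This is the summation over subsets that Moebius inversion undoes.\<close>

lemma num_indep_power:
  assumes "finite S"
  shows "num_indep E S ^ k = (\<Sum>U\<in>Pow S. num_covers E k U)"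
proof -
  let ?I = "{J. J \<subseteq> S \<and> indep E J}"
  let ?C = "\<lambda>U. {Js. length Js = k \<and> set Js \<subseteq> Collect (indep E) \<and> \<Union>(set Js) = U}"
  have "num_indep E S ^ k = card {Js. set Js \<subseteq> ?I \<and> length Js = k}"
    unfolding num_indep_def using assms by (intro card_lists_length_eq [symmetric]) simp
  also have "{Js. set Js \<subseteq> ?I \<and> length Js = k} = (\<Union>U\<in>Pow S. ?C U)"
    by auto
  also have "card \<dots> = (\<Sum>U\<in>Pow S. card (?C U))"
    using assms by (intro card_UN_disjoint) (auto intro: finite_covers finite_subset)
  finally show ?thesis
    by (simp add: num_covers_def)
qed

lemma num_covers_le:
  assumes "finite S"
  shows "num_covers E k S \<le> 2 ^ (card S * k)"
proof -
  have "num_covers E k S \<le> num_indep E S ^ k"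
    unfolding num_indep_power [OF assms] using assms by (intro member_le_sum) auto
  also have "num_indep E S \<le> card (Pow S)"
    unfolding num_indep_def using assms by (intro card_mono) auto
  then have "num_indep E S ^ k \<le> (2 ^ card S) ^ k"
    using assms by (intro power_mono) (simp_all add: card_Pow)
  finally show ?thesis
    by (simp add: power_mult)
qed

lemma num_indep_le: "finite S \<Longrightarrow> num_indep E S \<le> 2 ^ card S"
  unfolding num_indep_def by (subst card_Pow [symmetric]) (auto intro: card_mono)

lemma num_indep_empty: "num_indep E {} = 1"
proof -
  have "{J. J \<subseteq> {} \<and> indep E J} = {{}}"
    by (auto simp: indep_def)
  then show ?thesis
    by (simp add: num_indep_def)
qed

text \<open>Moebius inversion yields the sign of \<open>card S - card A\<close>. Splitting off
  \<open>(-1) ^ card S\<close> leaves the parity of \<open>card A\<close> alone, which a table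
  indexed by \<open>A\<close> can store; the factor in front does not affect vanishing.\<close>

lemma num_covers_eq_alternating_sum:
  assumes "finite S"
  shows "int (num_covers E k S) = (-1) ^ card S * (\<Sum>A\<in>Pow S. (-1) ^ card A * int (num_indep E A ^ k))"
proof -
  have "int (num_covers E k S) = (\<Sum>A\<in>Pow S. (-1) ^ (card S - card A) * int (num_indep E A ^ k))"
    using assms by (intro inclusion_exclusion_mobius) (simp_all add: num_indep_power)
  also have "\<dots> = (\<Sum>A\<in>Pow S. (-1) ^ card S * ((-1) ^ card A * int (num_indep E A ^ k)))"
  proof (rule sum.cong)
    fix A assume "A \<in> Pow S"
    then have "card A \<le> card S"
      using assms by (intro card_mono) auto
    then have "(-1) ^ (card S - card A) = ((-1) ^ card S * (-1) ^ card A :: int)"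
      by (metis add_diff_inverse_nat diff_add_inverse2 left_minus_one_mult_self linorder_not_less
          mult.commute power_add)
    then show "(-1) ^ (card S - card A) * int (num_indep E A ^ k)
        = (-1) ^ card S * ((-1) ^ card A * int (num_indep E A ^ k))"
      by simp
  qed simp
  finally show ?thesis
    by (simp add: sum_distrib_left)
qed

text \<open>Independent subsets are split by whether they contain \<open>v\<close>; removing
  \<open>v\<close> from one that does leaves an independent set of non-neighbours of
  \<open>v\<close>. A loop \<open>{v}\<close> would spoil the way back.\<close>

lemma num_indep_insert:
  assumes "finite S" "v \<notin> S" "{v} \<notin> E"
  shows "num_indep E (insert v S) = num_indep E S + num_indep E {u \<in> S. {v, u} \<notin> E}"
proof -
  let ?A = "{J. J \<subseteq> S \<and> indep E J}"
  let ?B = "{J. J \<subseteq> {u \<in> S. {v, u} \<notin> E} \<and> indep E J}"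
  have "{J. J \<subseteq> insert v S \<and> indep E J} = ?A \<union> insert v ` ?B"
  proof (intro equalityI subsetI)
    fix J assume J: "J \<in> {J. J \<subseteq> insert v S \<and> indep E J}"
    show "J \<in> ?A \<union> insert v ` ?B"
    proof (cases "v \<in> J")
      case True
      then have "J = insert v (J - {v})" "J - {v} \<in> ?B"
        using J by (auto simp: indep_def)
      then show ?thesis by blast
    qed (use J in auto)
  next
    fix J assume "J \<in> ?A \<union> insert v ` ?B"
    then show "J \<in> {J. J \<subseteq> insert v S \<and> indep E J}"
      using assms(3) by (auto simp: indep_def insert_commute)
  qed
  moreover have "card (?A \<union> insert v ` ?B) = card ?A + card (insert v ` ?B)"
    using assms by (intro card_Un_disjoint) auto
  moreover have "inj_on (insert v) ?B"
    using assms(2) by (intro inj_onI) (auto simp: insert_ident subset_iff)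
  ultimately show ?thesis
    by (simp add: num_indep_def card_image)
qed

section \<open>Covers and the chromatic number\<close>

lemma simple_graphD:
  assumes "simple_graph V E" "{u, v} \<in> E"
  shows "u \<in> V" "v \<in> V" "u \<noteq> v"
  using assms by (auto simp: simple_graph_def doubleton_eq_iff dest!: subsetD)

text \<open>\<open>LEAST\<close> is informative only if some colouring exists; an injection of the
  finite vertex set into the naturals is one.\<close>

lemma proper_coloring_obtain_least:
  assumes "simple_graph V E"
  obtains c where "proper_coloring E c" "card (c ` V) = chromatic_number V E"
proof -
  have fin: "finite V"
    using assms by (simp add: simple_graph_def)
  obtain f :: "'a \<Rightarrow> nat" where f: "inj_on f V"
    using fin finite_imp_inj_to_nat_seg by metis
  have "proper_coloring E f"
    unfolding proper_coloring_def
  proof (intro allI impI notI)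
    fix u v assume "{u, v} \<in> E" "f u = f v"
    then show False
      using simple_graphD [OF assms] f by (meson inj_onD)
  qed
  then have "\<exists>c. proper_coloring E c \<and> card (c ` V) = card (f ` V)"
    by blast
  then have "\<exists>c. proper_coloring E c \<and> card (c ` V) = chromatic_number V E"
    unfolding chromatic_number_def by (rule LeastI)
  then show ?thesis
    using that by blast
qed

lemma chromatic_number_le:
  "proper_coloring E c \<Longrightarrow> chromatic_number V E \<le> card (c ` V)"
  unfolding chromatic_number_def by (rule Least_le) blast

text \<open>A cover gives a colouring by choosing for each vertex a member that contains it; the
  colour classes of a colouring form a cover.\<close>

lemma num_covers_pos_iff:
  assumes G: "simple_graph V E"
  shows "num_covers E k V > 0 \<longleftrightarrow> chromatic_number V E \<le> k"
proof
  have fin: "finite V"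
    using G by (simp add: simple_graph_def)
  {
    assume "num_covers E k V > 0"
    then have "{Js. length Js = k \<and> set Js \<subseteq> Collect (indep E) \<and> \<Union>(set Js) = V} \<noteq> {}"
      unfolding num_covers_def by (intro notI) simp
    then obtain Js where Js: "length Js = k" "set Js \<subseteq> Collect (indep E)" "\<Union>(set Js) = V"
      by blast
    \<comment> \<open>Any choice works: two vertices with the same index lie in one independent
      set.\<close>
    define c where "c v = (SOME i. i < k \<and> v \<in> Js ! i)" for v
    have c: "c v < k \<and> v \<in> Js ! c v" if "v \<in> V" for v
    proof -
      have "\<exists>i. i < k \<and> v \<in> Js ! i"
        using that Js by (metis UnionE in_set_conv_nth)
      then show ?thesis
        unfolding c_def by (rule someI_ex)
    qed
    have "proper_coloring E c"
      unfolding proper_coloring_def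
    proof (intro allI impI notI)
      fix u v assume uv: "{u, v} \<in> E" "c u = c v"
      then have "u \<in> V" "v \<in> V"
        using simple_graphD [OF G] by blast+
      then have "u \<in> Js ! c u" "v \<in> Js ! c u" "Js ! c u \<in> set Js"
        using c [of u] c [of v] uv Js(1) by auto
      then show False
        using Js(2) uv(1) by (auto simp: indep_def)
    qed
    then have "chromatic_number V E \<le> card (c ` V)"
      by (rule chromatic_number_le)
    also have "\<dots> \<le> card {..<k}"
      using c by (intro card_mono) auto
    finally show "chromatic_number V E \<le> k"
      by simp
  }
  assume k: "chromatic_number V E \<le> k"
  obtain c where c: "proper_coloring E c" "card (c ` V) = chromatic_number V E"
    using proper_coloring_obtain_least [OF G] .
  define cs where "cs = sorted_list_of_set (c ` V)"
  \<comment> \<open>Empty sets pad the list of colour classes to length exactly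
    \<open>k\<close>.\<close>
  define Js where "Js = map (\<lambda>x. {v \<in> V. c v = x}) cs @ replicate (k - chromatic_number V E) {}"
  have cs: "set cs = c ` V" "length cs = chromatic_number V E"
    using fin c(2) by (simp_all add: cs_def)
  have "length Js = k"
    using k cs by (simp add: Js_def)
  moreover have "set Js \<subseteq> Collect (indep E)"
    using c(1) unfolding proper_coloring_def by (auto simp: Js_def indep_def) metis
  moreover have "\<Union>(set Js) = V"
    using cs(1) by (auto simp: Js_def)
  ultimately have "Js \<in> {Js. length Js = k \<and> set Js \<subseteq> Collect (indep E) \<and> \<Union>(set Js) = V}"
    by simp
  then show "num_covers E k V > 0"
    unfolding num_covers_def using finite_covers [OF fin] by (metis (lifting) card_gt_0_iff empty_iff)
qed

lemma chromatic_number_le_card: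
  assumes "simple_graph V E"
  shows "chromatic_number V E \<le> card V"
proof -
  have "finite V"
    using assms by (simp add: simple_graph_def)
  then show ?thesis
    by (metis assms card_image_le proper_coloring_obtain_least)
qed

section \<open>Common multiples of the first integers\<close>

text \<open>The fractions \<open>1 / (k * (n choose k))\<close> form the Leibniz harmonic triangle.
  Each is an integral combination of \<open>1 / m\<close> with \<open>1 \<le> m \<le> n\<close>, so
  \<open>N\<close> times it is an integer.\<close>

lemma times_binomial_dvd:
  assumes "\<And>m. 1 \<le> m \<Longrightarrow> m \<le> n \<Longrightarrow> m dvd N" "1 \<le> k" "k \<le> n"
  shows "k * (n choose k) dvd (N :: nat)"
proof -
  \<comment> \<open>The quotient is an integer rather than a natural number because the induction
    step subtracts two quotients.\<close>
  have "\<exists>q. int N = q * int (k * (n choose k))"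
    using assms(2,1,3)
  proof (induction k arbitrary: n rule: nat_induct_at_least)
    case base
    then have "n dvd N" by simp
    then show ?case by (auto simp: dvd_def mult.commute)
  next
    case (Suc k)
    obtain n' where n: "n = Suc n'"
      using Suc.prems(2) by (cases n) auto
    obtain q where q: "int N = q * int (k * (n choose k))"
      using Suc.IH [of n] Suc.prems by auto
    obtain q' where q': "int N = q' * int (k * (n' choose k))"
      using Suc.IH [of n'] Suc.prems n by auto
    text \<open>With \<open>B n k = 1 / (k * (n choose k))\<close>, this is \<open>B n (k + 1) = B (n - 1) k - B n k\<close>.\<close>
    have "int N = (q' - q) * int (Suc k * (n choose Suc k))"
    proof -
      have 1: "Suc k * (n choose Suc k) = n * (n' choose k)"
        unfolding n using Suc_times_binomial_eq [of n' k] by (simp add: mult.commute)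
      have 2: "(n - k) * (n choose k) = n * (n' choose k)"
        unfolding n by (metis binomial_absorb_comp diff_Suc_1)
      have 2: "(int n - int k) * int (n choose k) = int n * int (n' choose k)"
        using 2 Suc.prems(2) by (metis Suc_leD of_nat_diff of_nat_mult)
      have q'2: "int n * int N = q' * int k * ((int n - int k) * int (n choose k))"
        using q' 2 by (metis (no_types, opaque_lifting) mult.assoc mult.left_commute of_nat_mult)
      have "int k * ((q' - q) * int (Suc k * (n choose Suc k)))
          = q' * int k * ((int n - int k) * int (n choose k))
            - q * int k * ((int n - int k) * int (n choose k))"
        unfolding 1 of_nat_mult 2 by (simp add: algebra_simps)
      also have "\<dots> = int n * int N - (int n - int k) * int N"
        using q'2 q by (simp add: algebra_simps)
      also have "\<dots> = int k * int N"
        by (simp add: algebra_simps)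
      finally show ?thesis
        using Suc.hyps by simp
    qed
    then show ?case by blast
  qed
  then show ?thesis
    by (metis dvd_triv_right int_dvd_int_iff)
qed

text \<open>Put \<open>m = e + 1\<close>, so that the divisors reach \<open>2 * m\<close>. A nonzero
  \<open>N\<close> would be at least \<open>m * (2 * m choose m)\<close>, hence at least
  \<open>4 ^ m / 2 = 2 ^ (2 * e + 1)\<close>, contrary to \<open>N \<le> 2 ^ e\<close>.\<close>

lemma less_power2_dvd_imp_zero:
  assumes "\<And>m. 1 \<le> m \<Longrightarrow> m \<le> 2 * e + 2 \<Longrightarrow> m dvd N" "N \<le> 2 ^ e"
  shows "N = (0 :: nat)"
proof (rule ccontr)
  assume "N \<noteq> 0"
  let ?m = "e + 1"
  have "?m * ((2 * ?m) choose ?m) dvd N"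
    using assms(1) by (intro times_binomial_dvd) auto
  then have le: "?m * ((2 * ?m) choose ?m) \<le> N"
    using \<open>N \<noteq> 0\<close> by (intro dvd_imp_le) auto
  have "4 ^ ?m / (2 * real ?m) \<le> real ((2 * ?m) choose ?m)"
    using central_binomial_lower_bound [of ?m] by simp
  then have "4 ^ ?m \<le> 2 * real (?m * ((2 * ?m) choose ?m))"
    by (simp add: divide_le_eq algebra_simps del: binomial_Suc_Suc)
  also have "\<dots> \<le> 2 * 2 ^ e"
    using of_nat_mono [OF le_trans [OF le assms(2)], where 'a = real]
    by (intro mult_left_mono) (simp_all only: of_nat_power of_nat_numeral)
  finally have "(2::real) ^ (2 * ?m) \<le> 2 ^ (e + 1)"
    by (simp add: power_mult)
  then show False
    by (subst (asm) power_increasing_iff) auto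
qed

section \<open>Vertex sets as binary numbers\<close>

lemma set_decode_subset_iff: "set_decode x \<subseteq> {..<n} \<longleftrightarrow> x < 2 ^ n"
proof
  assume "set_decode x \<subseteq> {..<n}"
  then have "x \<le> set_encode {..<n}"
    by (intro subset_decode_imp_le) simp
  also have "\<dots> < 2 ^ n"
    by (simp add: set_encode_def sum_power2 flip: atLeast0LessThan)
  finally show "x < 2 ^ n" .
next
  assume x: "x < 2 ^ n"
  show "set_decode x \<subseteq> {..<n}"
  proof
    fix u assume u: "u \<in> set_decode x"
    have "u < n"
    proof (rule ccontr)
      assume "\<not> u < n"
      then have "x < 2 ^ u"
        using x by (meson less_le_trans linorder_not_less one_le_numeral power_increasing)
      then show False
        using u by (simp add: set_decode_def)
    qed
    then show "u \<in> {..<n}" by simp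
  qed
qed

lemma sum_set_decode: "(\<Sum>x<2 ^ n. f (set_decode x)) = (\<Sum>A\<in>Pow {..<n}. f A)"
proof (rule sum.reindex_bij_betw)
  show "bij_betw set_decode {..<2 ^ n} (Pow {..<n})"
  proof (rule bij_betw_byWitness [where f' = set_encode])
    show "\<forall>A\<in>Pow {..<n}. set_decode (set_encode A) = A"
      by (meson PowD finite_lessThan finite_subset set_encode_inverse)
    then show "set_encode ` Pow {..<n} \<subseteq> {..<2 ^ n}"
      by (auto simp flip: set_decode_subset_iff)
  qed (auto simp flip: set_decode_subset_iff)
qed

lemma set_encode_less: "A \<subseteq> {..<n} \<Longrightarrow> set_encode A < 2 ^ n"
  by (metis finite_lessThan finite_subset set_decode_subset_iff set_encode_inverse)

text \<open>One round of the loop that removes the neighbours of a vertex bit by bit.\<close>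

lemma set_encode_filter_Suc:
  "set_encode {u \<in> A. u < Suc j \<and> Q u} = set_encode {u \<in> A. u < j \<and> Q u} + of_bool (j \<in> A \<and> Q j) * 2 ^ j"
proof (cases "j \<in> A \<and> Q j")
  case True
  then have "{u \<in> A. u < Suc j \<and> Q u} = insert j {u \<in> A. u < j \<and> Q u}"
    by auto
  then show ?thesis
    using True by simp
next
  case False
  then have "{u \<in> A. u < Suc j \<and> Q u} = {u \<in> A. u < j \<and> Q u}"
    by (auto simp: less_Suc_eq)
  then show ?thesis
    using False by simp
qed

text \<open>The codes from \<open>2 ^ v\<close> up to \<open>2 ^ Suc v\<close> are those of the sets
  with largest element \<open>v\<close>; with them the table doubles.\<close>

lemma set_decode_plus_power:
  assumes "x < 2 ^ v"
  shows "set_decode (2 ^ v + x) = insert v (set_decode x)" "v \<notin> set_decode x"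
proof -
  show "v \<notin> set_decode x"
    using assms by (auto simp flip: set_decode_subset_iff)
  then show "set_decode (2 ^ v + x) = insert v (set_decode x)"
    by (rule set_decode_plus_power_2)
qed

section \<open>Structured programs with time bounds\<close>

datatype com = Block "instr list" | Seq com com (infixr ";;" 60) | While nat com

fun csize :: "com \<Rightarrow> nat" where
  "csize (Block is) = length is"
| "csize (c ;; d) = csize c + csize d"
| "csize (While r c) = csize c + 2"

text \<open>Jump targets are absolute, so the position \<open>p\<close> of the first instruction is
  a parameter. The length of the code does not depend on it, hence the exit of a loop is known
  before its body is compiled.\<close>

fun compile :: "nat \<Rightarrow> com \<Rightarrow> program" where
  "compile p (Block is) = is"
| "compile p (c ;; d) = compile p c @ compile (p + csize c) d"
| "compile p (While r c) = JumpZero r (p + csize c + 2) # compile (p + 1) c @ [Jump p]"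

lemma length_compile [simp]: "length (compile p c) = csize c"
  by (induction c arbitrary: p) auto

definition fits :: "nat \<Rightarrow> memory \<Rightarrow> bool" where
  "fits w m \<longleftrightarrow> (\<forall>a. m a < 2 ^ w)"

text \<open>The side conditions of \<open>computes_within\<close> are part of the run, so that they
  survive concatenation. The memory consists of all cells that a \<open>w\<close>-bit word can
  address.\<close>

inductive reaches :: "program \<Rightarrow> nat \<Rightarrow> config \<Rightarrow> nat \<Rightarrow> config \<Rightarrow> bool" for P w where
  refl: "fits w (snd s) \<Longrightarrow> reaches P w s 0 s"
| step: "\<lbrakk>fits w (snd s); \<not> halted P s; accessed (P ! fst s) (snd s) \<subseteq> {..<2 ^ w};
          reaches P w (step P s) t s'\<rbrakk> \<Longrightarrow> reaches P w s (Suc t) s'"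

lemma reaches_trans:
  "reaches P w s t s' \<Longrightarrow> reaches P w s' t' s'' \<Longrightarrow> reaches P w s (t + t') s''"
  by (induction rule: reaches.induct) (auto intro: reaches.step)

lemma reaches_fits: "reaches P w s t s' \<Longrightarrow> fits w (snd s')"
  by (induction rule: reaches.induct)

lemma reaches_imp_computes_within:
  assumes "reaches P w (initial_config xs) t s" "halted P s" "snd s 0 = y" "t \<le> T"
    "length xs \<le> 2 ^ w"
  shows "computes_within P xs y T (2 ^ w) w"
proof -
  have "(step P ^^ t) s0 = s \<and>
      (\<forall>i<t. accessed (P ! fst ((step P ^^ i) s0)) (snd ((step P ^^ i) s0)) \<subseteq> {..<2 ^ w}) \<and>
      (\<forall>i<Suc t. fits w (snd ((step P ^^ i) s0)))"
    if "reaches P w s0 t s" for s0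
    using that
  proof induction
    case (step s t s')
    \<comment> \<open>\<open>reaches\<close> grows at the front, so iteration is unfolded from the
      first step.\<close>
    have "(step P ^^ Suc i) s = (step P ^^ i) (step P s)" for i
      by (simp add: funpow_swap1)
    then show ?case
      using step by (simp only: All_less_Suc2 funpow_0) auto
  qed auto
  from this [OF assms(1)] show ?thesis
    using assms(2-) unfolding computes_within_def run_def fits_def by (intro exI [of _ t]) (auto simp: less_Suc_eq_le)
qed

text \<open>
  The bound 64 on the static addresses is arbitrary; it makes them fit into the memory of
  \<open>2 ^ w\<close> cells as soon as \<open>6 \<le> w\<close>. Dynamic addresses are values, which fit anyway.
\<close>

fun safe :: "nat \<Rightarrow> instr \<Rightarrow> memory \<Rightarrow> bool" where
  "safe w (Const a k) m \<longleftrightarrow> a < 64 \<and> k < 2 ^ w"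
| "safe w (Move a b) m \<longleftrightarrow> a < 64 \<and> b < 64"
| "safe w (Load a b) m \<longleftrightarrow> a < 64 \<and> b < 64"
| "safe w (Store a b) m \<longleftrightarrow> a < 64 \<and> b < 64"
| "safe w (Add a b c) m \<longleftrightarrow> a < 64 \<and> b < 64 \<and> c < 64 \<and> m b + m c < 2 ^ w"
| "safe w (Sub a b c) m \<longleftrightarrow> a < 64 \<and> b < 64 \<and> c < 64"
| "safe w (Mult a b c) m \<longleftrightarrow> a < 64 \<and> b < 64 \<and> c < 64 \<and> m b * m c < 2 ^ w"
| "safe w (Div a b c) m \<longleftrightarrow> a < 64 \<and> b < 64 \<and> c < 64"
| "safe w (Jump l) m \<longleftrightarrow> False"
| "safe w (JumpZero a l) m \<longleftrightarrow> False"

text \<open>The counter 0 is a dummy: the memory after an instruction does not depend on the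
  counter.\<close>

abbreviation effect :: "instr \<Rightarrow> memory \<Rightarrow> memory" where
  "effect i m \<equiv> snd (exec i (0, m))"

fun effects :: "instr list \<Rightarrow> memory \<Rightarrow> memory" where
  "effects [] m = m"
| "effects (i # is) m = effects is (effect i m)"

fun all_safe :: "nat \<Rightarrow> instr list \<Rightarrow> memory \<Rightarrow> bool" where
  "all_safe w [] m \<longleftrightarrow> True"
| "all_safe w (i # is) m \<longleftrightarrow> safe w i m \<and> all_safe w is (effect i m)"

lemma effects_append: "effects (is @ js) m = effects js (effects is m)"
  by (induction "is" arbitrary: m) auto

lemma all_safe_append: "all_safe w (is @ js) m \<longleftrightarrow> all_safe w is m \<and> all_safe w js (effects is m)"
  by (induction "is" arbitrary: m) auto

lemma safe_exec: "safe w i m \<Longrightarrow> exec i (p, m) = (p + 1, effect i m)"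
  by (cases i) auto

lemma safe_fits: "safe w i m \<Longrightarrow> fits w m \<Longrightarrow> fits w (effect i m)"
  by (cases i) (auto simp: fits_def intro: le_less_trans [OF diff_le_self] le_less_trans [OF div_le_dividend])

lemma safe_accessed:
  assumes "safe w i m" "fits w m" "6 \<le> w"
  shows "accessed i m \<subseteq> {..<2 ^ w}"
proof -
  have "(2 :: nat) ^ 6 \<le> 2 ^ w"
    using assms(3) by (intro power_increasing) auto
  then have "a < 64 \<Longrightarrow> a < 2 ^ w" for a :: nat
    by simp
  then show ?thesis
    using assms(1,2) by (cases i) (auto simp: fits_def)
qed

section \<open>A program logic for total correctness with running times\<close>

text \<open>Quantifying over the surrounding code \<open>xs\<close> and \<open>ys\<close> makes a
  triple usable wherever the code is placed; it includes termination at the end of the code.\<close>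

definition triple :: "nat \<Rightarrow> (memory \<Rightarrow> bool) \<Rightarrow> com \<Rightarrow> nat \<Rightarrow> (memory \<Rightarrow> bool) \<Rightarrow> bool" where
  "triple w A c t B \<longleftrightarrow>
     (\<forall>P xs ys m. P = xs @ compile (length xs) c @ ys \<longrightarrow> fits w m \<longrightarrow> A m \<longrightarrow>
        (\<exists>t'\<le>t. \<exists>m'. reaches P w (length xs, m) t' (length xs + csize c, m') \<and> B m'))"

lemma triple_compile:
  assumes "triple w A c t B" "fits w m" "A m"
  shows "\<exists>t'\<le>t. \<exists>m'. reaches (compile 0 c) w (0, m) t' (csize c, m') \<and> B m'"
  using assms(1) [unfolded triple_def, rule_format, of "compile 0 c" "[]" "[]" m] assms(2,3) by simp

lemma triple_conseq:
  assumes "triple w A c t B" "\<And>m. fits w m \<Longrightarrow> A' m \<Longrightarrow> A m" "\<And>m. B m \<Longrightarrow> B' m" "t \<le> t'"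
  shows "triple w A' c t' B'"
  unfolding triple_def
proof (intro allI impI)
  fix P xs ys m
  assume "P = xs @ compile (length xs) c @ ys" "fits w m" "A' m"
  then obtain s m' where "s \<le> t" "reaches P w (length xs, m) s (length xs + csize c, m')" "B m'"
    using assms(1,2) unfolding triple_def by blast
  then show "\<exists>s\<le>t'. \<exists>m'. reaches P w (length xs, m) s (length xs + csize c, m') \<and> B' m'"
    using assms(3,4) le_trans by blast
qed

lemma triple_Block:
  assumes "\<And>m. fits w m \<Longrightarrow> A m \<Longrightarrow> all_safe w is m \<and> B (effects is m)" "6 \<le> w" "length is = t"
  shows "triple w A (Block is) t B"
proof -
  have "reaches (xs @ is @ ys) w (length xs, m) (length is) (length xs + length is, effects is m)"
    if "fits w m" "all_safe w is m" for xs ys m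
    using that
  \<comment> \<open>Each executed instruction is shifted from the block to the prefix
    \<open>xs\<close>, whose length thereby remains the program counter.\<close>
  proof (induction "is" arbitrary: xs m)
    case (Cons i "is")
    let ?P = "xs @ (i # is) @ ys"
    have "step ?P (length xs, m) = (length (xs @ [i]), effect i m)"
      using Cons.prems by (simp add: step_def halted_def nth_append safe_exec [of w i m "length xs"])
    moreover have "reaches ((xs @ [i]) @ is @ ys) w (length (xs @ [i]), effect i m) (length is)
        (length (xs @ [i]) + length is, effects is (effect i m))"
      using Cons.prems by (intro Cons.IH) (auto intro: safe_fits)
    moreover have "accessed (?P ! length xs) m \<subseteq> {..<2 ^ w}"
      using Cons.prems assms(2) by (simp add: nth_append safe_accessed)
    ultimately have "reaches ?P w (length xs, m) (Suc (length is))
        (length (xs @ [i]) + length is, effects is (effect i m))"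
      using Cons.prems by (intro reaches.step) (auto simp: halted_def)
    then show ?case
      by simp
  qed (simp add: reaches.refl)
  then show ?thesis
    using assms(1) unfolding triple_def compile.simps csize.simps assms(3) [symmetric] by (blast intro: order_refl)
qed

lemma triple_Seq:
  assumes c: "triple w A c t B" and d: "triple w B d t' C"
  shows "triple w A (c ;; d) (t + t') C"
  unfolding triple_def
proof (intro allI impI)
  fix P xs ys m
  assume P: "P = xs @ compile (length xs) (c ;; d) @ ys" and m: "fits w m" "A m"
  have "P = xs @ compile (length xs) c @ (compile (length xs + csize c) d @ ys)"
    by (simp add: P)
  then obtain t1 m1 where 1: "t1 \<le> t" "B m1"
      "reaches P w (length xs, m) t1 (length xs + csize c, m1)"
    using c m unfolding triple_def by blast
  have "P = (xs @ compile (length xs) c) @ compile (length (xs @ compile (length xs) c)) d @ ys"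
    by (simp add: P)
  moreover have "fits w m1"
    using reaches_fits [OF 1(3)] by simp
  ultimately obtain t2 m2 where 2: "t2 \<le> t'" "C m2"
      "reaches P w (length (xs @ compile (length xs) c), m1) t2
         (length (xs @ compile (length xs) c) + csize d, m2)"
    using d 1(2) unfolding triple_def by blast
  have "reaches P w (length xs, m) (t1 + t2) (length xs + csize (c ;; d), m2)"
    using reaches_trans [OF 1(3), of t2 "(length xs + csize (c ;; d), m2)"] 2(3) by (simp add: add.assoc)
  then show "\<exists>s\<le>t + t'. \<exists>m'. reaches P w (length xs, m) s (length xs + csize (c ;; d), m') \<and> C m'"
    using 1(1) 2(1,2) by (meson add_mono)
qed

text \<open>The invariant is indexed by the number of completed rounds. A round pays 2 for the test
  and the jump back; the final \<open>+ 1\<close> is the test that leaves the loop.\<close>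

lemma triple_While:
  assumes body: "\<And>j. j < N \<Longrightarrow> triple w (I j) c t (I (Suc j))"
    and nonzero: "\<And>j m. j < N \<Longrightarrow> I j m \<Longrightarrow> m r \<noteq> 0"
    and zero: "\<And>m. I N m \<Longrightarrow> m r = 0"
    and "r < 64" "6 \<le> w"
  shows "triple w (I 0) (While r c) (N * (t + 2) + 1) (I N)"
  unfolding triple_def
proof (intro allI impI)
  fix P xs ys m
  assume P: "P = xs @ compile (length xs) (While r c) @ ys" and m: "fits w m" "I 0 m"
  have P': "P = (xs @ [JumpZero r (length xs + csize c + 2)])
      @ compile (length (xs @ [JumpZero r (length xs + csize c + 2)])) c @ (Jump (length xs) # ys)"
    by (simp add: P)
  have at: "P ! length xs = JumpZero r (length xs + csize c + 2)" "length xs < length P"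
    "P ! (length xs + csize c + 1) = Jump (length xs)" "length xs + csize c + 1 < length P"
    by (auto simp: P nth_append)
  \<comment> \<open>\<open>Move r r\<close> serves only to read off that a static address lies in
    the memory.\<close>
  have r: "r < 2 ^ w"
    using safe_accessed [of w "Move r r" "\<lambda>_. 0"] assms(4,5) by (simp add: fits_def)
  have "\<exists>t'\<le>(N - j) * (t + 2) + 1. \<exists>m'. reaches P w (length xs, m) t' (length xs + csize c + 2, m') \<and> I N m'"
    if "j \<le> N" "fits w m" "I j m" for j m
    using that
  proof (induction "N - j" arbitrary: j m)
    case 0
    then have "reaches P w (length xs, m) (Suc 0) (length xs + csize c + 2, m)"
      using zero [of m] at r by (intro reaches.step) (auto simp: halted_def step_def intro: reaches.refl)
    then show ?case
      using 0 by (intro exI [of _ "Suc 0"]) auto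
  next
    case (Suc d)
    then have j: "j < N"
      by simp
    have "\<exists>t'\<le>t. \<exists>m'. reaches P w (length xs + 1, m) t' (length xs + 1 + csize c, m') \<and> I (Suc j) m'"
      using body [OF j] P' Suc.prems unfolding triple_def
      by (metis (no_types, lifting) length_append_singleton Suc_eq_plus1)
    then obtain t1 m1 where 1: "t1 \<le> t" "I (Suc j) m1"
      "reaches P w (length xs + 1, m) t1 (length xs + 1 + csize c, m1)"
      by blast
    have m1: "fits w m1"
      using reaches_fits [OF 1(3)] by simp
    have "\<exists>t'\<le>(N - Suc j) * (t + 2) + 1. \<exists>m'. reaches P w (length xs, m1) t' (length xs + csize c + 2, m') \<and> I N m'"
      using Suc.hyps(2) j 1(2) m1 by (intro Suc.hyps(1)) auto
    then obtain t2 m2 where 2: "t2 \<le> (N - Suc j) * (t + 2) + 1" "I N m2"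
      "reaches P w (length xs, m1) t2 (length xs + csize c + 2, m2)"
      by blast
    have "reaches P w (length xs + 1 + csize c, m1) (Suc t2) (length xs + csize c + 2, m2)"
      using m1 2(3) at by (intro reaches.step) (auto simp: halted_def step_def)
    with 1(3) have "reaches P w (length xs + 1, m) (t1 + Suc t2) (length xs + csize c + 2, m2)"
      by (rule reaches_trans)
    then have "reaches P w (length xs, m) (Suc (t1 + Suc t2)) (length xs + csize c + 2, m2)"
      using nonzero [OF j Suc.prems(3)] Suc.prems at r by (intro reaches.step) (auto simp: halted_def step_def)
    moreover have "Suc (t1 + Suc t2) \<le> (N - j) * (t + 2) + 1"
    proof -
      have "N - j = Suc (N - Suc j)"
        using j by simp
      then show ?thesis
        using 1(1) 2(1) by simp
    qed
    ultimately show ?case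
      using 2(2) by blast
  qed
  from this [of 0 m] m show "\<exists>t'\<le>N * (t + 2) + 1.
      \<exists>m'. reaches P w (length xs, m) t' (length xs + csize (While r c), m') \<and> I N m'"
    by (simp add: add.assoc)
qed

text \<open>Naming the initial memory allows later assertions to say which cells are unchanged since
  then.\<close>

lemma triple_fix_state:
  "(\<And>m0. fits w m0 \<Longrightarrow> A m0 \<Longrightarrow> triple w (\<lambda>m. m = m0) c t B) \<Longrightarrow> triple w A c t B"
  unfolding triple_def by blast

section \<open>The program\<close>

text \<open>
  Cells 0, 2 and 24 hold \<open>n\<close>, 1 and 2. With \<open>D = n * n + 100\<close>, the input cell \<open>i\<close> moves to \<open>D + i\<close>, and
  the table starts at \<open>F = 2 * D + 2\<close>; after \<open>relocate\<close>, cells 6 and 7 hold \<open>D + 1\<close> and \<open>F\<close>, and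
  after \<open>make_table\<close>, cell 10 holds \<open>2 ^ n\<close>.

  The input occupies the cells that are to serve as registers. Only the entries \<open>(v, u)\<close> with
  \<open>u < v\<close> are ever read, so cells 1 and 2, with the entries \<open>(0, 0)\<close> and \<open>(0, 1)\<close>, are free from the
  start. They suffice to save cells 3 to 24 by straight-line code, after which a loop moves the rest.
\<close>

definition save_cells :: "nat \<Rightarrow> instr list" where
  "save_cells k = concat (map (\<lambda>i. [Store 1 i, Add 1 1 2]) [3..<k])"

definition copy_init :: "instr list" where
  "copy_init = [Const 3 25, Mult 4 0 0, Const 5 24, Sub 4 4 5]"

definition copy_body :: "instr list" where
  "copy_body = [Load 5 3, Store 1 5, Add 3 3 2, Add 1 1 2, Sub 4 4 2]"

text \<open>\<open>F\<close> is twice \<open>D + 1\<close>, so one addition produces it from cell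
  6.\<close>

definition set_bases :: "instr list" where
  "set_bases = [Mult 6 0 0, Const 5 101, Add 6 6 5, Add 7 6 6]"

text \<open>Cell 1 starts at \<open>n * n + 103 = D + 3\<close>, the destination of input cell 3;
  cell 2 then becomes the constant 1.\<close>

definition relocate :: com where
  "relocate = Block ([Mult 1 0 0, Const 2 103, Add 1 1 2, Const 2 1] @ save_cells 25) ;;
     Block copy_init ;; While 4 (Block copy_body) ;; Block set_bases"

text \<open>
  For \<open>x < 2 ^ n\<close>, the table holds at \<open>F + 2 * x\<close> the number of independent subsets of the set coded
  by \<open>x\<close>, and at \<open>F + 2 * x + 1\<close> the parity of the size of that set. The entries with leading
  bit \<open>v\<close> come from those below \<open>2 ^ v\<close>; cell 19 runs through \<open>F + 2 * y\<close> where \<open>y\<close> codes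
  the non-neighbours of \<open>v\<close> met so far.
\<close>

definition neighbour_body :: "instr list" where
  "neighbour_body = [Div 21 17 24, Add 22 21 21, Sub 22 17 22, Move 17 21, Load 23 20,
     Sub 22 22 23, Mult 22 22 18, Add 19 19 22, Add 18 18 18, Add 20 20 2, Sub 16 16 2]"

text \<open>Cells 9 and 11 hold \<open>v\<close> and the address of its matrix row, 14 and 15 the
  address of entry \<open>x\<close> and \<open>x\<close> itself. Cell 16 counts the bits left, 17
  holds the unread bits of \<open>x\<close>, and 20 runs through the row. Cell 18 is twice the
  current power of two, since an entry occupies two cells.\<close>

definition entry_init :: "instr list" where
  "entry_init = [Move 16 9, Move 17 15, Move 18 24, Move 19 7, Move 20 11]"

text \<open>The second half flips the parity of entry \<open>x\<close>: the new set has one more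
  element.\<close>

definition entry_store :: "instr list" where
  "entry_store = [Load 21 14, Load 22 19, Add 21 21 22, Store 12 21, Add 12 12 2, Add 14 14 2,
     Load 21 14, Sub 21 2 21, Store 12 21, Add 12 12 2, Add 14 14 2, Add 15 15 2, Sub 13 13 2]"

definition block_body :: com where
  "block_body = Block entry_init ;; While 16 (Block neighbour_body) ;; Block entry_store"

definition table_init :: "instr list" where
  "table_init = [Const 24 2, Move 8 0, Const 9 0, Move 10 2, Move 11 6, Store 7 2, Add 12 7 2,
     Const 13 0, Store 12 13, Add 12 12 2]"

definition vertex_init :: "instr list" where
  "vertex_init = [Move 13 10, Move 14 7, Const 15 0]"

definition vertex_next :: "instr list" where
  "vertex_next = [Add 9 9 2, Add 10 10 10, Add 11 11 0, Sub 8 8 2]"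

definition make_table :: com where
  "make_table = Block table_init ;;
     While 8 (Block vertex_init ;; While 13 block_body ;; Block vertex_next)"

text \<open>
  Cell 5 holds the modulus minus 1, which stands for \<open>-1\<close>. Cell 4 remains 1 as long as all the
  residues have been 0, because subtraction is truncated.
\<close>

definition power_body :: "instr list" where
  "power_body = [Mult 16 16 13, Div 14 16 8, Mult 14 14 8, Sub 16 16 14, Sub 17 17 2]"

text \<open>The power loop starts not from 1 but from the sign: cell 16 becomes 1 or, for odd sets,
  the residue of -1.\<close>

definition term_init :: "instr list" where
  "term_init = [Load 13 12, Div 14 13 8, Mult 14 14 8, Sub 13 13 14, Add 12 12 2, Load 15 12,
     Add 12 12 2, Sub 14 2 15, Mult 15 15 5, Add 16 14 15, Move 17 3]"

definition term_add :: "instr list" where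
  "term_add = [Add 9 9 16, Div 14 9 8, Mult 14 14 8, Sub 9 9 14, Sub 11 11 2]"

definition sum_body :: com where
  "sum_body = Block term_init ;; While 17 (Block power_body) ;; Block term_add"

definition modulus_init :: "instr list" where
  "modulus_init = [Add 8 5 2, Const 9 0, Move 11 10, Move 12 7]"

definition modulus_next :: "instr list" where
  "modulus_next = [Sub 4 4 9, Sub 5 5 2]"

definition modulus_body :: com where
  "modulus_body = Block modulus_init ;; While 11 sum_body ;; Block modulus_next"

text \<open>For \<open>k = 0\<close> the flag in cell 4 is \<open>n\<close> itself, because the
  empty list covers only the empty set.\<close>

definition search_init :: "instr list" where
  "search_init = [Const 3 0, Move 4 0]"

text \<open>Cell 5 counts from \<open>2 * n * n + 2\<close> down to 1, so the moduli, one larger,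
  run from \<open>2 * n * n + 3\<close> down to 2.\<close>

definition search_next :: "instr list" where
  "search_next = [Add 3 3 2, Move 4 2, Mult 5 0 0, Add 5 5 5, Add 5 5 24]"

definition search :: com where
  "search = Block search_init ;; While 4 (Block search_next ;; While 5 modulus_body) ;; Block [Move 0 3]"

definition chromatic_com :: com where
  "chromatic_com = relocate ;; make_table ;; search"

section \<open>Correctness and running time\<close>

text \<open>Kept in the shape in which \<open>triple_Seq\<close> and \<open>triple_While\<close>
  assemble it; it grows like \<open>n ^ 4 * 2 ^ n\<close>.\<close>

definition time_bound :: "nat \<Rightarrow> nat" where
  "time_bound n =
     (48 + (4 + ((n * n * (5 + 2) + 1) + 4))) +
     ((10 + (n * ((3 + ((2 ^ n * (13 * n + 21) + 1) + 4)) + 2) + 1)) +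
      (2 + ((n * ((5 + ((2 * (n * n) + 2) * (2 ^ n * (7 * n + 19) + 9) + 1)) + 2) + 1) + 1)))"

lemma row_less:
  fixes v n u :: nat
  assumes "v < n" "u < n"
  shows "v * n + u < n * n"
proof -
  have "v * n + u < Suc v * n"
    using assms(2) by simp
  also have "\<dots> \<le> n * n"
    using assms(1) by (intro mult_le_mono1) simp
  finally show ?thesis .
qed

lemma nth_graph_input:
  assumes "v < n" "u < n"
  shows "graph_input n E ! (1 + v * n + u) = of_bool ({v, u} \<in> E)"
  using assms row_less [OF assms] by (simp add: graph_input_def)

lemma graph_input_le: "i < length (graph_input n E) \<Longrightarrow> graph_input n E ! i \<le> n + 1"
  by (cases i) (simp_all add: graph_input_def)

text \<open>The two demands on the word length: a product of two residues must fit, and so must all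
  addresses up to the end of the table, with some room for loop counters and weights.\<close>

locale graph_machine =
  fixes n w :: nat and E :: "nat set set"
  assumes graph: "simple_graph {..<n} E"
    and w_products: "(2 * (n * n) + 3) * (2 * (n * n) + 3) < 2 ^ w"
    and w_addresses: "2 * (n * n) + 4 * 2 ^ n + 300 < (2 :: nat) ^ w"
begin

text \<open>Beyond both \<open>n * n\<close> and the static addresses, so the copy overlaps neither
  its source nor the registers.\<close>

definition D :: nat where "D = n * n + 100"
definition F :: nat where "F = 2 * D + 2"

definition adj_ok :: "memory \<Rightarrow> bool" where
  "adj_ok m \<longleftrightarrow> (\<forall>v<n. \<forall>u<v. m (D + 1 + v * n + u) = of_bool ({v, u} \<in> E))"

definition table_ok :: "nat \<Rightarrow> memory \<Rightarrow> bool" where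
  "table_ok s m \<longleftrightarrow> (\<forall>x<s. m (F + 2 * x) = num_indep E (set_decode x) \<and>
     m (F + 2 * x + 1) = of_bool (odd (card (set_decode x))))"

lemma w_ge: "6 \<le> w"
proof (rule ccontr)
  assume "\<not> 6 \<le> w"
  then have "(2 :: nat) ^ w \<le> 2 ^ 6"
    by (intro power_increasing) auto
  then show False
    using w_addresses by simp
qed

lemma F_ge: "200 < F" and D_ge: "64 < D" and D_less_F: "D + n * n + 2 \<le> F"
  and w_F: "F + 4 * 2 ^ n + 90 < 2 ^ w"
  using w_addresses by (simp_all add: F_def D_def)

lemma adj_ok_cong:
  assumes "adj_ok m" "\<And>a. 64 \<le> a \<Longrightarrow> a < F \<Longrightarrow> m' a = m a"
  shows "adj_ok m'"
proof -
  have "m' (D + 1 + v * n + u) = m (D + 1 + v * n + u)" if "v < n" "u < v" for v u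
    using row_less [of v n u] that D_ge D_less_F by (intro assms(2)) simp_all
  then show ?thesis
    using assms(1) by (simp add: adj_ok_def)
qed

lemma table_ok_cong:
  "table_ok s m \<Longrightarrow> (\<And>a. F \<le> a \<Longrightarrow> m' a = m a) \<Longrightarrow> table_ok s m'"
  by (simp add: table_ok_def)

section \<open>Filling the table\<close>

lemma neighbour_loop:
  assumes v: "v < n" "x < 2 ^ v"
    and m0: "m0 2 = 1" "m0 24 = 2" "m0 16 = v" "m0 17 = x" "m0 18 = 2" "m0 19 = F"
      "m0 20 = D + 1 + v * n" "adj_ok m0"
  shows "triple w (\<lambda>m. m = m0) (While 16 (Block neighbour_body)) (v * (11 + 2) + 1)
    (\<lambda>m. (\<forall>a. a \<notin> {16..23} \<longrightarrow> m a = m0 a) \<and>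
         m 19 = F + 2 * set_encode {u \<in> set_decode x. {v, u} \<notin> E})"
proof -
  define I where "I j m \<longleftrightarrow> (\<forall>a. a \<notin> {16..23} \<longrightarrow> m a = m0 a) \<and> m 16 = v - j \<and> m 17 = x div 2 ^ j \<and>
      m 18 = 2 * 2 ^ j \<and> m 19 = F + 2 * set_encode {u \<in> set_decode x. u < j \<and> {v, u} \<notin> E} \<and>
      m 20 = D + 1 + v * n + j" for j and m :: memory
  have "triple w (I 0) (While 16 (Block neighbour_body)) (v * (11 + 2) + 1) (I v)"
  proof (rule triple_While)
    fix j assume j: "j < v"
    show "triple w (I j) (Block neighbour_body) 11 (I (Suc j))"
    proof (rule triple_Block)
      fix m assume fits: "fits w m" and m: "I j m"
      define X A e g where "X = x div 2 ^ j" and "A = D + 1 + v * n + j"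
        and "e = set_encode {u \<in> set_decode x. u < j \<and> {v, u} \<notin> E}"
        and "g = (of_bool (j \<in> set_decode x \<and> {v, j} \<notin> E) :: nat)"
      note defs = X_def A_def e_def g_def
      have eqs: "m 2 = 1" "m 24 = 2" "m 16 = v - j" "m 17 = X" "m 18 = 2 * 2 ^ j" "m 19 = F + 2 * e" "m 20 = A"
        using m m0 by (auto simp: I_def defs)
      have frame: "m a = m0 a" if "a \<notin> {16..23}" for a
        using m that by (auto simp: I_def)
      have "m A = of_bool ({v, j} \<in> E)"
        using frame m0(8) v(1) j by (simp add: A_def D_def adj_ok_def)
      moreover have "X - (X div 2 + X div 2) = of_bool (j \<in> set_decode x)"
        by (simp add: X_def set_decode_def minus_mult_div_eq_mod mod2_eq_if flip: mult_2)
      \<comment> \<open>Truncated subtraction of the adjacency entry from the bit computes "in the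
        set and not adjacent".\<close>
      ultimately have g: "X - (X div 2 + X div 2 + m A) = g"
        unfolding diff_diff_left [symmetric] by (simp add: g_def)
      have A: "k < 64 \<Longrightarrow> A \<noteq> k" for k
        by (auto simp: A_def D_def)
      have "X div 2 + X div 2 \<le> X"
        by simp
      also have "X < 2 ^ w"
        using fits unfolding fits_def eqs(4) [symmetric] by blast
      finally have half: "X div 2 + X div 2 < 2 ^ w" .
      have "e < 2 ^ j"
        unfolding e_def by (rule set_encode_less) auto
      moreover have "2 * 2 ^ j \<le> (2 :: nat) ^ n"
        using v j by (metis Suc_leI less_trans one_le_numeral power_Suc power_increasing)
      moreover have "Suc A < F"
        using row_less [of v n j] v j D_less_F by (simp add: A_def)
      moreover have "0 < (2 :: nat) ^ j"
        by simp
      moreover have "g * (2 * 2 ^ j) \<le> 2 * 2 ^ j"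
        by (simp add: g_def)
      ultimately have safe: "g * (2 * 2 ^ j) < 2 ^ w" "F + 2 * e + g * (2 * 2 ^ j) < 2 ^ w"
          "4 * 2 ^ j < (2 :: nat) ^ w" "Suc A < 2 ^ w"
        using w_F by linarith+
      have s: "set_encode {u \<in> set_decode x. u < Suc j \<and> {v, u} \<notin> E} = e + g * 2 ^ j"
        unfolding e_def g_def by (rule set_encode_filter_Suc)
      have div2: "x div (2 * 2 ^ j) = X div 2"
        unfolding X_def by (metis div_mult2_eq mult.commute)
      have "all_safe w neighbour_body m"
        by (simp add: neighbour_body_def eqs A g half safe)
      moreover have "I (Suc j) (effects neighbour_body m)"
        by (simp add: neighbour_body_def eqs A g I_def s div2 frame) (simp add: A_def)
      ultimately show "all_safe w neighbour_body m \<and> I (Suc j) (effects neighbour_body m)" ..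
    qed (simp_all add: w_ge neighbour_body_def)
  qed (auto simp: I_def w_ge)
  moreover have "I 0 m0"
    using m0 by (simp add: I_def)
  \<comment> \<open>All bits of \<open>x\<close> lie below \<open>v\<close>, so after
    \<open>v\<close> rounds none is left out.\<close>
  moreover have "{u \<in> set_decode x. u < v \<and> {v, u} \<notin> E} = {u \<in> set_decode x. {v, u} \<notin> E}"
    using v(2) by (auto simp flip: set_decode_subset_iff)
  ultimately show ?thesis
    by (elim triple_conseq) (auto simp: I_def)
qed

lemma num_indep_set_decode_plus_power:
  assumes "v < n" "x < 2 ^ v"
  shows "num_indep E (set_decode (2 ^ v + x)) = num_indep E (set_decode x) +
    num_indep E (set_decode (set_encode {u \<in> set_decode x. {v, u} \<notin> E}))"
proof -
  have "{v} \<notin> E"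
    using simple_graphD(3) [OF graph, of v v] by auto
  then show ?thesis
    using assms set_decode_plus_power [OF assms(2)] by (simp add: num_indep_insert)
qed

lemma num_indep_set_decode_le:
  assumes "x < 2 ^ n"
  shows "num_indep E (set_decode x) \<le> 2 ^ n"
proof -
  have "card (set_decode x) \<le> n"
    using assms card_mono [of "{..<n}" "set_decode x"] by (simp add: set_decode_subset_iff)
  then have "(2 :: nat) ^ card (set_decode x) \<le> 2 ^ n"
    by (intro power_increasing) simp_all
  then show ?thesis
    by (rule le_trans [OF num_indep_le [OF finite_set_decode]])
qed

text \<open>Entry \<open>2 ^ v + j\<close> depends on two entries below \<open>2 ^ v\<close>, all of
  which are present before the loop starts.\<close>

lemma block_loop:
  assumes v: "v < n"
    and m0: "m0 2 = 1" "m0 24 = 2" "m0 7 = F" "m0 9 = v" "m0 11 = D + 1 + v * n"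
      "m0 12 = F + 2 * 2 ^ v" "m0 13 = 2 ^ v" "m0 14 = F" "m0 15 = 0" "adj_ok m0" "table_ok (2 ^ v) m0"
  shows "triple w (\<lambda>m. m = m0) (While 13 block_body) (2 ^ v * ((5 + (v * (11 + 2) + 1 + 13)) + 2) + 1)
    (\<lambda>m. (\<forall>a. a \<notin> {12..23} \<and> a < F \<longrightarrow> m a = m0 a) \<and>
         m 12 = F + 2 * 2 ^ Suc v \<and> table_ok (2 ^ Suc v) m)"
proof -
  define I where "I j m \<longleftrightarrow> (\<forall>a. a \<notin> {12..23} \<and> a < F \<longrightarrow> m a = m0 a) \<and>
      m 12 = F + 2 * (2 ^ v + j) \<and> m 13 = 2 ^ v - j \<and> m 14 = F + 2 * j \<and> m 15 = j \<and>
      table_ok (2 ^ v + j) m" for j and m :: memory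
  have "triple w (I 0) (While 13 block_body) (2 ^ v * ((5 + (v * (11 + 2) + 1 + 13)) + 2) + 1) (I (2 ^ v))"
  proof (rule triple_While)
    fix j :: nat assume j: "j < 2 ^ v"
    show "triple w (I j) block_body (5 + (v * (11 + 2) + 1 + 13)) (I (Suc j))"
    proof (rule triple_fix_state)
      fix m1 assume fits1: "fits w m1" and m1: "I j m1"
      define m2 where "m2 = effects entry_init m1"
      define t where "t = set_encode {u \<in> set_decode j. {v, u} \<notin> E}"
      define B C G where "B = F + 2 * j" and "C = F + 2 * (2 ^ v + j)" and "G = F + 2 * t"
      note defs = B_def C_def G_def
      have low: "k < 64 \<Longrightarrow> k < F" for k
        using F_ge by simp
      have ne: "B \<noteq> k" "C \<noteq> k" "G \<noteq> k" "Suc B \<noteq> k" "Suc C \<noteq> k" "Suc G \<noteq> k" if "k < 64" for k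
        using that F_ge by (auto simp: defs)
      have eqs1: "m1 2 = 1" "m1 24 = 2" "m1 7 = F" "m1 9 = v" "m1 11 = D + 1 + v * n" "m1 12 = C"
          "m1 13 = 2 ^ v - j" "m1 14 = B" "m1 15 = j"
        using m1 m0 low by (auto simp: I_def defs)
      have frame2: "m2 a = m1 a" if "a \<notin> {16..23}" for a
        using that by (auto simp: m2_def entry_init_def)
      have adj: "adj_ok m2"
        using m0(10) by (rule adj_ok_cong) (use frame2 m1 in \<open>simp add: I_def\<close>)
      define Q where "Q m \<longleftrightarrow> (\<forall>a. a \<notin> {16..23} \<longrightarrow> m a = m1 a) \<and> m 19 = G" for m :: memory
      have "triple w (\<lambda>m. m = m1) (Block entry_init) 5 (\<lambda>m. m = m2)"
        by (rule triple_Block) (simp_all add: entry_init_def m2_def w_ge)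
      moreover have "triple w (\<lambda>m. m = m2) (While 16 (Block neighbour_body)) (v * (11 + 2) + 1) Q"
      proof (rule triple_conseq [OF neighbour_loop [OF v j]])
        show "m2 2 = 1" "m2 24 = 2" "m2 16 = v" "m2 17 = j" "m2 18 = 2" "m2 19 = F" "m2 20 = D + 1 + v * n"
          by (simp_all add: m2_def entry_init_def eqs1)
      qed (auto simp: adj Q_def frame2 G_def t_def)
      moreover have "triple w Q (Block entry_store) 13 (I (Suc j))"
      proof (rule triple_Block)
        fix m assume fits: "fits w m" and m: "Q m"
        have frame: "m a = m1 a" if "a \<notin> {16..23}" for a
          using m that by (auto simp: Q_def)
        have eqs: "m 2 = 1" "m 12 = C" "m 13 = 2 ^ v - j" "m 14 = B" "m 15 = j" "m 19 = G"
          using frame eqs1 m by (auto simp: Q_def)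
        have "t < 2 ^ v"
          \<comment> \<open>Deleting neighbours leaves a subset of the set coded by
            \<open>j\<close>, whose elements are still below \<open>v\<close>.\<close>
          unfolding t_def using j by (intro set_encode_less) (auto simp flip: set_decode_subset_iff)
        then have "m1 B = num_indep E (set_decode j)" "m1 G = num_indep E (set_decode t)"
            "m1 (Suc B) = of_bool (odd (card (set_decode j)))"
          using m1 j by (auto simp: I_def table_ok_def defs)
        moreover have "m B = m1 B" "m G = m1 G" "m (Suc B) = m1 (Suc B)"
          using F_ge by (auto intro!: frame simp: defs)
        ultimately have vals: "m B + m G = num_indep E (set_decode (2 ^ v + j))"
            "m (Suc B) = of_bool (odd (card (set_decode j)))"
          using num_indep_set_decode_plus_power [OF v j] by (simp_all add: t_def)
        have odd: "Suc 0 - m (Suc B) = of_bool (odd (card (set_decode (2 ^ v + j))))"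
          using set_decode_plus_power [OF j] vals(2) by simp
        have pow: "2 * 2 ^ v \<le> (2 :: nat) ^ n"
          using v by (metis Suc_leI one_le_numeral power_Suc power_increasing)
        have "num_indep E (set_decode (2 ^ v + j)) \<le> 2 ^ n"
          using pow j by (intro num_indep_set_decode_le) linarith
        then have safe: "m B + m G < 2 ^ w" "Suc (Suc C) < 2 ^ w" "Suc (Suc B) < 2 ^ w"
            "Suc C < 2 ^ w" "Suc B < 2 ^ w" "Suc j < 2 ^ w"
          unfolding vals using w_F pow j by (simp_all add: defs)
        have CB: "C \<noteq> B" "B \<noteq> C" "C \<noteq> Suc B" "Suc C \<noteq> B" "Suc B \<noteq> C" "B \<noteq> Suc C" "Suc 0 \<noteq> C"
          using F_ge by (auto simp: defs)
        let ?m = "effects entry_store m"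
        have "all_safe w entry_store m"
          by (simp add: entry_store_def eqs ne CB safe)
        moreover have upd: "?m C = num_indep E (set_decode (2 ^ v + j))"
            "?m (Suc C) = of_bool (odd (card (set_decode (2 ^ v + j))))"
            "?m 12 = F + 2 * (2 ^ v + Suc j)" "?m 13 = 2 ^ v - Suc j" "?m 14 = F + 2 * Suc j" "?m 15 = Suc j"
          by (simp_all add: entry_store_def eqs ne CB odd flip: vals(1)) (simp_all add: defs)
        moreover have frame': "?m a = m a" if "a \<notin> {12..23}" "a \<noteq> C" "a \<noteq> Suc C" for a
          using that by (simp add: entry_store_def eqs ne CB) auto
        have "?m a = m0 a" if "a \<notin> {12..23}" "a < F" for a
          using that frame' frame m1 by (simp add: defs I_def)
        moreover have "table_ok (2 ^ v + Suc j) ?m"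
          unfolding table_ok_def
        proof (intro allI impI)
          fix x assume "x < 2 ^ v + Suc j"
          show "?m (F + 2 * x) = num_indep E (set_decode x) \<and>
              ?m (F + 2 * x + 1) = of_bool (odd (card (set_decode x)))"
          proof (cases "x = 2 ^ v + j")
            case True
            then show ?thesis
              using upd(1,2) by (simp add: C_def)
          next
            case False
            then have "x < 2 ^ v + j"
              using \<open>x < 2 ^ v + Suc j\<close> by simp
            moreover have "F + 2 * x \<noteq> C" "F + 2 * x \<noteq> Suc C" "F + 2 * x + 1 \<noteq> C" "F + 2 * x + 1 \<noteq> Suc C"
              using False unfolding C_def by presburger+
            ultimately show ?thesis
              using m1 frame' frame F_ge by (simp add: I_def table_ok_def)
          qed
        qed
        ultimately show "all_safe w entry_store m \<and> I (Suc j) ?m"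
          by (simp add: I_def)
      qed (simp_all add: w_ge entry_store_def)
      ultimately show "triple w (\<lambda>m. m = m1) block_body (5 + (v * (11 + 2) + 1 + 13)) (I (Suc j))"
        unfolding block_body_def by (intro triple_Seq)
    qed
  qed (auto simp: I_def w_ge)
  moreover have "I 0 m0"
    using m0 by (simp add: I_def)
  ultimately show ?thesis
    by (elim triple_conseq) (auto simp: I_def mult_2)
qed

lemma make_table:
  "triple w (\<lambda>m. m 0 = n \<and> m 2 = 1 \<and> m 6 = D + 1 \<and> m 7 = F \<and> adj_ok m) make_table
     (10 + (n * ((3 + ((2 ^ n * (13 * n + 21) + 1) + 4)) + 2) + 1))
     (\<lambda>m. m 0 = n \<and> m 2 = 1 \<and> m 7 = F \<and> m 10 = 2 ^ n \<and> m 24 = 2 \<and> table_ok (2 ^ n) m)"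
  unfolding make_table_def
proof (rule triple_Seq)
  define I where "I j m \<longleftrightarrow> m 0 = n \<and> m 2 = 1 \<and> m 7 = F \<and> m 24 = 2 \<and> m 8 = n - j \<and> m 9 = j \<and>
    m 10 = 2 ^ j \<and> m 11 = D + 1 + j * n \<and> m 12 = F + 2 * 2 ^ j \<and> table_ok (2 ^ j) m \<and> adj_ok m"
    for j and m :: memory
  show "triple w (\<lambda>m. m 0 = n \<and> m 2 = 1 \<and> m 6 = D + 1 \<and> m 7 = F \<and> adj_ok m) (Block table_init) 10 (I 0)"
  proof (rule triple_Block)
    fix m assume fits: "fits w m"
      and "m 0 = n \<and> m 2 = 1 \<and> m 6 = D + 1 \<and> m 7 = F \<and> adj_ok m"
    then have eqs: "m 0 = n" "m 2 = 1" "m 6 = D + 1" "m 7 = F" and adj: "adj_ok m"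
      by auto
    have ne: "F \<noteq> k" "Suc F \<noteq> k" "k \<noteq> F" if "k < 64" for k
      using that F_ge by auto
    have safe: "Suc (Suc F) < 2 ^ w" "Suc F < 2 ^ w" "2 < (2 :: nat) ^ w" "0 < (2 :: nat) ^ w"
      using w_F F_ge by auto
    have "all_safe w table_init m"
      by (simp add: table_init_def eqs ne safe)
    moreover have "table_ok (2 ^ 0) (effects table_init m)"
      by (simp add: table_ok_def table_init_def eqs ne num_indep_empty)
    moreover have "adj_ok (effects table_init m)"
      using adj by (rule adj_ok_cong) (simp add: table_init_def eqs ne)
    ultimately show "all_safe w table_init m \<and> I 0 (effects table_init m)"
      by (simp add: I_def) (simp add: table_init_def eqs ne)
  qed (simp_all add: w_ge table_init_def)
  have "triple w (I 0) (While 8 (Block vertex_init ;; While 13 block_body ;; Block vertex_next))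
      (n * ((3 + ((2 ^ n * (13 * n + 21) + 1) + 4)) + 2) + 1) (I n)"
  proof (rule triple_While)
    fix v assume v: "v < n"
    show "triple w (I v) (Block vertex_init ;; While 13 block_body ;; Block vertex_next)
        (3 + ((2 ^ n * (13 * n + 21) + 1) + 4)) (I (Suc v))"
    proof (rule triple_fix_state)
      fix m0 assume m0: "I v m0"
      define m1 where "m1 = effects vertex_init m0"
      define Q where "Q m \<longleftrightarrow> (\<forall>a. a \<notin> {12..23} \<and> a < F \<longrightarrow> m a = m1 a) \<and>
         m 12 = F + 2 * 2 ^ Suc v \<and> table_ok (2 ^ Suc v) m" for m
      have eqs0: "m0 0 = n" "m0 2 = 1" "m0 7 = F" "m0 24 = 2" "m0 8 = n - v" "m0 9 = v" "m0 10 = 2 ^ v"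
        "m0 11 = D + 1 + v * n" "m0 12 = F + 2 * 2 ^ v" and tab: "table_ok (2 ^ v) m0" and adj: "adj_ok m0"
        using m0 by (auto simp: I_def)
      have frame1: "m1 a = m0 a" if "a \<notin> {13..15}" for a
        using that by (auto simp: m1_def vertex_init_def)
      have adj1: "adj_ok m1"
        using adj by (rule adj_ok_cong) (simp add: frame1)
      have tab1: "table_ok (2 ^ v) m1"
        using tab by (rule table_ok_cong) (use F_ge in \<open>simp add: frame1\<close>)
      have pow: "2 * 2 ^ v \<le> (2 :: nat) ^ n"
        using v by (metis Suc_leI one_le_numeral power_Suc power_increasing)
      have "triple w (\<lambda>m. m = m0) (Block vertex_init) 3 (\<lambda>m. m = m1)"
        using w_F by (intro triple_Block) (simp_all add: m1_def vertex_init_def w_ge)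
      moreover have "triple w (\<lambda>m. m = m1) (While 13 block_body) (2 ^ n * (13 * n + 21) + 1) Q"
      proof (rule triple_conseq [OF block_loop [OF v]])
        show "m1 2 = 1" "m1 24 = 2" "m1 7 = F" "m1 9 = v" "m1 11 = D + 1 + v * n"
          "m1 12 = F + 2 * 2 ^ v" "m1 13 = 2 ^ v" "m1 14 = F" "m1 15 = 0"
          by (simp_all add: m1_def vertex_init_def eqs0)
        \<comment> \<open>Every vertex is charged \<open>2 ^ n\<close> entries instead of
          \<open>2 ^ v\<close>; the loss is at most a polynomial factor.\<close>
        have "2 ^ v * ((5 + (v * (11 + 2) + 1 + 13)) + 2) \<le> (2 :: nat) ^ n * (13 * n + 21)"
          using v by (intro mult_mono) simp_all
        then show "2 ^ v * ((5 + (v * (11 + 2) + 1 + 13)) + 2) + 1 \<le> (2 :: nat) ^ n * (13 * n + 21) + 1"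
          by simp
      qed (auto simp: adj1 tab1 Q_def)
      moreover have "triple w Q (Block vertex_next) 4 (I (Suc v))"
      proof (rule triple_Block)
        fix m assume fits: "fits w m" and m: "Q m"
        have frame: "m a = m1 a" if "a \<notin> {12..23}" "a < F" for a
          using that m by (simp add: Q_def)
        have low: "k < F" if "k < 64" for k
          using that F_ge by simp
        have eqs: "m 0 = n" "m 2 = 1" "m 7 = F" "m 24 = 2" "m 8 = n - v" "m 9 = v" "m 10 = 2 ^ v"
          "m 11 = D + 1 + v * n" "m 12 = F + 2 * 2 ^ Suc v" "table_ok (2 ^ Suc v) m"
          using m by (simp_all add: frame frame1 eqs0 low Q_def)
        have "v * n + n \<le> n * n"
          using mult_le_mono1 [of "Suc v" n n] v by simp
        then have safe: "Suc v < 2 ^ w" "2 ^ v + 2 ^ v < (2 :: nat) ^ w" "Suc (D + v * n + n) < 2 ^ w"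
          using w_F D_less_F pow v less_exp [of n] by (simp_all)
        have "all_safe w vertex_next m"
          using safe by (simp add: vertex_next_def eqs add.assoc)
        moreover have "table_ok (2 ^ Suc v) (effects vertex_next m)"
          using eqs(10) by (rule table_ok_cong) (use F_ge in \<open>simp add: vertex_next_def eqs\<close>)
        moreover have "adj_ok (effects vertex_next m)"
          using adj1 by (rule adj_ok_cong) (simp add: vertex_next_def eqs frame)
        ultimately show "all_safe w vertex_next m \<and> I (Suc v) (effects vertex_next m)"
          by (simp add: I_def) (simp add: vertex_next_def eqs)
      qed (simp_all add: w_ge vertex_next_def)
      ultimately show "triple w (\<lambda>m. m = m0) (Block vertex_init ;; While 13 block_body ;; Block vertex_next)
          (3 + ((2 ^ n * (13 * n + 21) + 1) + 4)) (I (Suc v))"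
        by (intro triple_Seq)
    qed
  qed (auto simp: I_def w_ge)
  then show "triple w (I 0) (While 8 (Block vertex_init ;; While 13 block_body ;; Block vertex_next))
      (n * ((3 + ((2 ^ n * (13 * n + 21) + 1) + 4)) + 2) + 1)
      (\<lambda>m. m 0 = n \<and> m 2 = 1 \<and> m 7 = F \<and> m 10 = 2 ^ n \<and> m 24 = 2 \<and> table_ok (2 ^ n) m)"
    by (rule triple_conseq) (auto simp: I_def)
qed

section \<open>Moving the input out of the registers\<close>

text \<open>Apart from cell 1, writes go to \<open>D + 3\<close> and beyond, so the input cells
  still to be saved keep their contents.\<close>

lemma save_cells:
  assumes "3 \<le> k" "k \<le> 25" "m 1 = D + 3" "m 2 = 1"
  shows "all_safe w (save_cells k) m \<and> effects (save_cells k) m 1 = D + k \<and>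
    (\<forall>i. 3 \<le> i \<and> i < k \<longrightarrow> effects (save_cells k) m (D + i) = m i) \<and>
    (\<forall>a. a \<noteq> 1 \<and> a < D + 3 \<longrightarrow> effects (save_cells k) m a = m a)"
  using assms
proof (induction k rule: nat_induct_at_least)
  case base
  then show ?case
    by (simp add: save_cells_def)
next
  case (Suc k)
  let ?m = "effects (save_cells k) m"
  have IH: "all_safe w (save_cells k) m" "?m 1 = D + k"
    "\<And>i. 3 \<le> i \<Longrightarrow> i < k \<Longrightarrow> ?m (D + i) = m i" "\<And>a. a \<noteq> 1 \<Longrightarrow> a < D + 3 \<Longrightarrow> ?m a = m a"
    using Suc by simp_all
  have split: "save_cells (Suc k) = save_cells k @ [Store 1 k, Add 1 1 2]"
    using Suc by (simp add: save_cells_def)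
  have eqs: "?m (Suc 0) = D + k" "?m 2 = 1" "?m k = m k"
    using IH(2) IH(4) [of 2] IH(4) [of k] Suc D_ge by auto
  have ne: "D + k \<noteq> 1" "D + k \<noteq> 2" "Suc (D + k) < 2 ^ w"
    using D_ge D_less_F w_F F_def Suc.prems(1) by auto
  have step: "effects (save_cells (Suc k)) m = ?m(D + k := m k, 1 := D + Suc k)"
    using ne by (simp add: split effects_append eqs)
  have "all_safe w (save_cells (Suc k)) m"
    using ne Suc.prems(1) by (simp add: split all_safe_append IH(1) eqs)
  moreover have "\<forall>i. 3 \<le> i \<and> i < Suc k \<longrightarrow> effects (save_cells (Suc k)) m (D + i) = m i"
    using IH(3) D_ge by (auto simp: step less_Suc_eq)
  moreover have "\<forall>a. a \<noteq> 1 \<and> a < D + 3 \<longrightarrow> effects (save_cells (Suc k)) m a = m a"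
    using IH(4) Suc.hyps by (auto simp: step)
  moreover have "effects (save_cells (Suc k)) m 1 = D + Suc k"
    by (simp add: step)
  ultimately show ?case
    by blast
qed

lemma relocate:
  assumes inp: "\<And>v u. v < n \<Longrightarrow> u < v \<Longrightarrow> inp (1 + v * n + u) = of_bool ({v, u} \<in> E)"
  shows "triple w (\<lambda>m. m 0 = n \<and> (\<forall>i. 3 \<le> i \<and> i \<le> n * n \<longrightarrow> m i = inp i)) relocate
     (48 + (4 + ((n * n * (5 + 2) + 1) + 4)))
     (\<lambda>m. m 0 = n \<and> m 2 = 1 \<and> m 6 = D + 1 \<and> m 7 = F \<and> adj_ok m)"
proof -
  \<comment> \<open>The cells from 25 to \<open>n * n\<close> remain; for small \<open>n\<close>
    truncation makes this 0.\<close>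
  define N where "N = n * n - 24"
  define I where "I j m \<longleftrightarrow> m 0 = n \<and> m 1 = D + (25 + j) \<and> m 2 = 1 \<and> m 3 = 25 + j \<and> m 4 = N - j \<and>
     (\<forall>i. 3 \<le> i \<and> i < 25 + j \<and> i \<le> n * n \<longrightarrow> m (D + i) = inp i) \<and>
     (\<forall>i. 25 \<le> i \<and> i \<le> n * n \<longrightarrow> m i = inp i)" for j and m :: memory
  define J where "J m \<longleftrightarrow> m 0 = n \<and> m 1 = D + 25 \<and> m 2 = 1 \<and>
     (\<forall>i. 3 \<le> i \<and> i < 25 \<and> i \<le> n * n \<longrightarrow> m (D + i) = inp i) \<and>
     (\<forall>i. 25 \<le> i \<and> i \<le> n * n \<longrightarrow> m i = inp i)" for m :: memory
  have D_gt: "n * n + 64 < D"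
    by (simp add: D_def)
  have "triple w (\<lambda>m. m 0 = n \<and> (\<forall>i. 3 \<le> i \<and> i \<le> n * n \<longrightarrow> m i = inp i))
      (Block ([Mult 1 0 0, Const 2 103, Add 1 1 2, Const 2 1] @ save_cells 25)) 48 J"
  proof (rule triple_Block)
    fix m assume m: "m 0 = n \<and> (\<forall>i. 3 \<le> i \<and> i \<le> n * n \<longrightarrow> m i = inp i)"
    let ?m = "m(1 := n * n + 103, 2 := 1)"
    have "n * n + 103 < 2 ^ w" "n * n < 2 ^ w" "103 < (2::nat) ^ w" "1 < (2::nat) ^ w"
      using w_addresses by simp_all
    then have pre: "all_safe w [Mult 1 0 0, Const 2 103, Add 1 1 2, Const 2 1] m"
      "effects [Mult 1 0 0, Const 2 103, Add 1 1 2, Const 2 1] m = ?m"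
      using m by (simp_all add: fun_upd_twist)
    have saved: "all_safe w (save_cells 25) ?m" "effects (save_cells 25) ?m 1 = D + 25"
      "\<And>i. 3 \<le> i \<Longrightarrow> i < 25 \<Longrightarrow> effects (save_cells 25) ?m (D + i) = ?m i"
      "\<And>a. a \<noteq> 1 \<Longrightarrow> a < D + 3 \<Longrightarrow> effects (save_cells 25) ?m a = ?m a"
      using save_cells [of 25 ?m] by (auto simp: D_def)
    show "all_safe w ([Mult 1 0 0, Const 2 103, Add 1 1 2, Const 2 1] @ save_cells 25) m \<and>
        J (effects ([Mult 1 0 0, Const 2 103, Add 1 1 2, Const 2 1] @ save_cells 25) m)"
      unfolding all_safe_append effects_append pre J_def
      using pre(1) saved m D_gt by simp
  qed (simp_all add: w_ge save_cells_def length_concat comp_def sum_list_triv)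
  moreover have "triple w J (Block copy_init) 4 (I 0)"
  proof (rule triple_Block)
    fix m assume m: "J m"
    then have "m 0 = n"
      by (simp add: J_def)
    moreover have "n * n < 2 ^ w"
      using w_addresses by simp
    ultimately show "all_safe w copy_init m \<and> I 0 (effects copy_init m)"
      using m w_F F_ge D_gt by (simp add: copy_init_def I_def J_def N_def)
  qed (simp_all add: w_ge copy_init_def)
  moreover have "triple w (I 0) (While 4 (Block copy_body)) (n * n * (5 + 2) + 1) (I N)"
  proof (rule triple_conseq [OF triple_While])
    fix j assume j: "j < N"
    show "triple w (I j) (Block copy_body) 5 (I (Suc j))"
    proof (rule triple_Block)
      fix m assume m: "I j m"
      define C where "C = D + (25 + j)"
      have eqs: "m 0 = n" "m (Suc 0) = C" "m 2 = 1" "m 3 = 25 + j" "m 4 = N - j"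
        using m by (auto simp: I_def C_def)
      have ne: "C \<noteq> k" "k \<noteq> C" if "k < 64" for k
        using that D_ge by (auto simp: C_def)
      have load: "m (25 + j) = inp (25 + j)"
        using m j by (simp add: I_def N_def)
      have safe: "Suc C < 2 ^ w" "26 + j < 2 ^ w"
        using j D_less_F w_F by (simp_all add: C_def N_def)
      let ?m = "effects copy_body m"
      have upd: "?m = m(5 := inp (25 + j), C := inp (25 + j), 3 := 25 + Suc j, 1 := Suc C, 4 := N - Suc j)"
        by (simp add: copy_body_def eqs ne load)
      have "all_safe w copy_body m"
        using safe by (simp add: copy_body_def eqs ne)
      moreover have "?m (D + i) = inp i" if "3 \<le> i" "i < 25 + Suc j" "i \<le> n * n" for i
        using that m D_ge by (cases "i = 25 + j") (auto simp: upd C_def I_def)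
      \<comment> \<open>The source cells lie above the registers used for copying and below every
        destination.\<close>
      moreover have "?m i = inp i" if "25 \<le> i" "i \<le> n * n" for i
        using that m D_gt by (simp add: upd C_def I_def)
      moreover have "?m 0 = n" "?m 1 = D + (25 + Suc j)" "?m 2 = 1" "?m 3 = 25 + Suc j" "?m 4 = N - Suc j"
        by (simp_all add: upd eqs ne) (simp add: C_def)
      ultimately show "all_safe w copy_body m \<and> I (Suc j) ?m"
        by (simp add: I_def)
    qed (simp_all add: w_ge copy_body_def)
  next
    show "N * (5 + 2) + 1 \<le> n * n * (5 + 2) + 1"
      unfolding N_def by (intro add_right_mono mult_right_mono) simp_all
  qed (auto simp: I_def w_ge)
  moreover have "triple w (I N) (Block set_bases) 4
      (\<lambda>m. m 0 = n \<and> m 2 = 1 \<and> m 6 = D + 1 \<and> m 7 = F \<and> adj_ok m)"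
  proof (rule triple_Block)
    fix m assume m: "I N m"
    have eqs: "m 0 = n" "m 2 = 1" and copied: "\<And>i. 3 \<le> i \<Longrightarrow> i \<le> n * n \<Longrightarrow> m (D + i) = inp i"
      using m by (auto simp: I_def N_def)
    have "adj_ok m"
      unfolding adj_ok_def
    proof (intro allI impI)
      fix v u assume v: "v < n" "u < v"
      \<comment> \<open>From \<open>u < v < n\<close> follow \<open>v \<ge> 1\<close> and
        \<open>n \<ge> 2\<close>, so the input index is at least 3 and avoids the overwritten cells
        1 and 2.\<close>
      have "1 * 2 \<le> v * n"
        using v by (intro mult_mono) auto
      then have "m (D + (1 + v * n + u)) = inp (1 + v * n + u)"
        using row_less [of v n u] v by (intro copied) auto
      then show "m (D + 1 + v * n + u) = of_bool ({v, u} \<in> E)"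
        using inp [OF v] by (simp add: add.assoc)
    qed
    then have "adj_ok (effects set_bases m)"
      by (rule adj_ok_cong) (simp add: set_bases_def)
    moreover have "all_safe w set_bases m \<and> effects set_bases m 0 = n \<and> effects set_bases m 2 = 1 \<and>
        effects set_bases m 6 = D + 1 \<and> effects set_bases m 7 = F"
      using w_addresses by (simp add: set_bases_def eqs F_def D_def)
    ultimately show "all_safe w set_bases m \<and> effects set_bases m 0 = n \<and> effects set_bases m 2 = 1 \<and>
        effects set_bases m 6 = D + 1 \<and> effects set_bases m 7 = F \<and> adj_ok (effects set_bases m)"
      by blast
  qed (simp_all add: w_ge set_bases_def)
  ultimately show ?thesis
    unfolding relocate_def by (intro triple_Seq)
qed

section \<open>The alternating sum and its residues\<close>

text \<open>Cut off at \<open>s\<close> to serve as a loop invariant. It is an unbounded integer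
  that the program knows only through residues.\<close>

definition signed_sum :: "nat \<Rightarrow> nat \<Rightarrow> int" where
  "signed_sum k s = (\<Sum>x<s. (-1) ^ card (set_decode x) * int (num_indep E (set_decode x)) ^ k)"

lemma signed_sum_eq: "signed_sum k (2 ^ n) = (-1) ^ n * int (num_covers E k {..<n})"
proof -
  have "signed_sum k (2 ^ n) = (\<Sum>A\<in>Pow {..<n}. (-1) ^ card A * int (num_indep E A ^ k))"
    unfolding signed_sum_def by (subst sum_set_decode [symmetric]) simp
  then show ?thesis
    using num_covers_eq_alternating_sum [of "{..<n}" E k] by (simp add: mult.assoc flip: power_mult_distrib)
qed

text \<open>The moduli appear in the order of the loop. Since \<open>k \<le> n\<close>, the number
  of covers is at most \<open>2 ^ (n * n)\<close>, and \<open>less_power2_dvd_imp_zero\<close>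
  applies with \<open>e = n * n\<close>.\<close>

lemma all_moduli_iff:
  assumes "k \<le> n"
  shows "(\<forall>i<2 * (n * n) + 2. signed_sum k (2 ^ n) mod int (2 * (n * n) + 2 + 1 - i) = 0) \<longleftrightarrow>
    k < chromatic_number {..<n} E"
proof -
  let ?N = "num_covers E k {..<n}" and ?L = "2 * (n * n) + 2"
  have "signed_sum k (2 ^ n) mod int q = 0 \<longleftrightarrow> q dvd ?N" for q
    unfolding signed_sum_eq by (simp add: mod_eq_0_iff_dvd minus_one_power_iff)
  then have "(\<forall>i<?L. signed_sum k (2 ^ n) mod int (?L + 1 - i) = 0) \<longleftrightarrow> (\<forall>i<?L. ?L + 1 - i dvd ?N)"
    by presburger
  also have "\<dots> \<longleftrightarrow> ?N = 0"
  proof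
    assume dvd: "\<forall>i<?L. ?L + 1 - i dvd ?N"
    show "?N = 0"
    proof (rule less_power2_dvd_imp_zero)
      fix q assume q: "1 \<le> q" "q \<le> 2 * (n * n) + 2"
      show "q dvd ?N"
      \<comment> \<open>The loop does not test modulus 1, which divides everything.\<close>
      proof (cases "q = 1")
        case False
        then show ?thesis
          using q dvd [rule_format, of "?L + 1 - q"] by simp
      qed simp
    next
      have "?N \<le> 2 ^ (card {..<n} * k)"
        by (rule num_covers_le) simp
      also have "\<dots> \<le> 2 ^ (n * n)"
        using assms by (intro power_increasing) simp_all
      finally show "?N \<le> 2 ^ (n * n)" .
    qed
  qed simp
  also have "\<dots> \<longleftrightarrow> k < chromatic_number {..<n} E"
    using num_covers_pos_iff [OF graph, of k] by auto
  finally show ?thesis .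
qed

lemma power_loop:
  assumes m0: "m0 2 = 1" "m0 8 = q" "m0 13 = a" "m0 16 = c" "m0 17 = k"
    and less: "a < q" "c < q" "q \<le> 2 * (n * n) + 3"
  shows "triple w (\<lambda>m. m = m0) (While 17 (Block power_body)) (k * (5 + 2) + 1)
    (\<lambda>m. (\<forall>b. b \<notin> {14, 16, 17} \<longrightarrow> m b = m0 b) \<and> m 16 = c * a ^ k mod q)"
proof -
  define I where "I j m \<longleftrightarrow> (\<forall>b. b \<notin> {14, 16, 17} \<longrightarrow> m b = m0 b) \<and> m 17 = k - j \<and> m 16 = c * a ^ j mod q"
    for j and m :: memory
  have "triple w (I 0) (While 17 (Block power_body)) (k * (5 + 2) + 1) (I k)"
  proof (rule triple_While)
    fix j assume j: "j < k"
    show "triple w (I j) (Block power_body) 5 (I (Suc j))"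
    proof (rule triple_Block)
      fix m assume "fits w m" and m: "I j m"
      define t where "t = c * a ^ j mod q"
      have frame: "m b = m0 b" if "b \<notin> {14, 16, 17}" for b
        using that m by (simp add: I_def)
      have eqs: "m 2 = 1" "m 8 = q" "m 13 = a" "m 16 = t" "m 17 = k - j"
        using m m0 by (auto simp: I_def t_def)
      have "t < q"
        using less by (simp add: t_def)
      then have "t * a \<le> q * q"
        using less by (intro mult_mono) auto
      also have "\<dots> \<le> (2 * (n * n) + 3) * (2 * (n * n) + 3)"
        using less by (intro mult_mono) auto
      also note w_products
      finally have safe: "t * a < 2 ^ w" .
      moreover have "t * a div q * q \<le> t * a"
        by simp
      ultimately have safe': "t * a div q * q < 2 ^ w"
        by linarith
      have t: "t * a mod q = c * a ^ Suc j mod q"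
        unfolding t_def by (simp add: mod_mult_right_eq mult_ac)
      have "all_safe w power_body m"
        by (simp add: power_body_def eqs safe safe')
      moreover have "I (Suc j) (effects power_body m)"
        by (simp add: I_def power_body_def eqs frame minus_div_mult_eq_mod t) 
      ultimately show "all_safe w power_body m \<and> I (Suc j) (effects power_body m)" ..
    qed (simp_all add: w_ge power_body_def)
  qed (auto simp: I_def w_ge)
  moreover have "I 0 m0"
    using m0 less by (simp add: I_def)
  ultimately show ?thesis
    by (elim triple_conseq) (auto simp: I_def)
qed

text \<open>A table entry fits into a word although its \<open>k\<close>-th power may not; it is
  therefore reduced before the powering.\<close>

lemma sum_loop:
  assumes p: "1 \<le> p" "p \<le> 2 * (n * n) + 2"
    and m0: "m0 2 = 1" "m0 3 = k" "m0 5 = p" "m0 8 = Suc p" "m0 9 = 0" "m0 11 = 2 ^ n" "m0 12 = F"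
      "table_ok (2 ^ n) m0"
  shows "triple w (\<lambda>m. m = m0) (While 11 sum_body) (2 ^ n * ((11 + ((k * (5 + 2) + 1) + 5)) + 2) + 1)
    (\<lambda>m. (\<forall>b. b \<notin> {9, 11, 12, 13, 14, 15, 16, 17} \<longrightarrow> m b = m0 b) \<and>
         int (m 9) = signed_sum k (2 ^ n) mod int (Suc p))"
proof -
  define I where "I s m \<longleftrightarrow> (\<forall>b. b \<notin> {9, 11, 12, 13, 14, 15, 16, 17} \<longrightarrow> m b = m0 b) \<and>
      m 11 = 2 ^ n - s \<and> m 12 = F + 2 * s \<and> int (m 9) = signed_sum k s mod int (Suc p)"
    for s and m :: memory
  have "triple w (I 0) (While 11 sum_body) (2 ^ n * ((11 + ((k * (5 + 2) + 1) + 5)) + 2) + 1) (I (2 ^ n))"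
  proof (rule triple_While)
    fix s :: nat assume s: "s < 2 ^ n"
    show "triple w (I s) sum_body (11 + ((k * (5 + 2) + 1) + 5)) (I (Suc s))"
    proof (rule triple_fix_state)
      fix m1 assume fits1: "fits w m1" and m1: "I s m1"
      define m2 where "m2 = effects term_init m1"
      define B where "B = F + 2 * s"
      define x where "x = num_indep E (set_decode s)"
      define h where "h = card (set_decode s)"
      define c where "c = (if odd h then p else 1)"
      have ne: "B \<noteq> k" "Suc B \<noteq> k" "k \<noteq> B" if "k < 64" for k
        using that F_ge by (auto simp: B_def)
      have eqs1: "m1 2 = 1" "m1 3 = k" "m1 5 = p" "m1 8 = Suc p" "m1 11 = 2 ^ n - s" "m1 12 = B"
        using m1 m0 by (auto simp: I_def B_def)
      have "m1 (F + 2 * s) = m0 (F + 2 * s)" "m1 (F + 2 * s + 1) = m0 (F + 2 * s + 1)"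
        using m1 F_ge by (auto simp: I_def)
      then have entry: "m1 B = x" "m1 (Suc B) = of_bool (odd h)"
        using m0(8) s by (simp_all add: table_ok_def B_def x_def h_def)
      \<comment> \<open>The machine forms a remainder by subtracting a multiple of the modulus,
        which fits because it does not exceed the dividend.\<close>
      have "x div Suc p * Suc p \<le> x"
        by (rule div_times_less_eq_dividend)
      also have "x < 2 ^ w"
        using fits1 entry(1) by (auto simp: fits_def)
      finally have safe1: "x div Suc p * Suc p < 2 ^ w" .
      have "Suc p < 2 ^ w"
        using w_products p by (simp add: algebra_simps)
      then have safe: "Suc p < 2 ^ w" "p < 2 ^ w" "Suc (Suc B) < 2 ^ w" "Suc B < 2 ^ w" "0 < (2::nat) ^ w"
          "Suc 0 < (2::nat) ^ w"
        using w_F s F_ge by (auto simp: B_def)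
      have frame2: "m2 b = m1 b" if "b \<notin> {12, 13, 14, 15, 16, 17}" for b
        using that by (auto simp: m2_def term_init_def)
      have eqs2: "m2 8 = Suc p" "m2 13 = x mod Suc p" "m2 16 = c" "m2 17 = k" "m2 2 = 1" "m2 12 = F + 2 * Suc s"
        by (simp_all add: m2_def term_init_def eqs1 ne entry c_def minus_div_mult_eq_mod
            del: mult_Suc_right) (simp_all add: B_def)
      define Q where "Q m \<longleftrightarrow> (\<forall>b. b \<notin> {14, 16, 17} \<longrightarrow> m b = m2 b) \<and>
          m 16 = c * (x mod Suc p) ^ k mod Suc p" for m
      have "triple w (\<lambda>m. m = m1) (Block term_init) 11 (\<lambda>m. m = m2)"
      proof (rule triple_Block)
        fix m assume "m = m1"
        then show "all_safe w term_init m \<and> effects term_init m = m2"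
          using safe1 safe by (simp add: m2_def term_init_def eqs1 ne entry minus_div_mult_eq_mod
              del: mult_Suc_right)
      qed (simp_all add: w_ge term_init_def)
      moreover have "triple w (\<lambda>m. m = m2) (While 17 (Block power_body)) (k * (5 + 2) + 1) Q"
        unfolding Q_def using p by (intro power_loop eqs2) (auto simp: c_def)
      moreover have "triple w Q (Block term_add) 5 (I (Suc s))"
      proof (rule triple_Block)
        fix m assume "fits w m" and m: "Q m"
        define t where "t = c * (x mod Suc p) ^ k mod Suc p"
        have frame: "m b = m1 b" if "b \<notin> {12, 13, 14, 15, 16, 17}" for b
          using that m frame2 by (auto simp: Q_def)
        have eqs: "m 2 = 1" "m 8 = Suc p" "m 11 = 2 ^ n - s" "m 12 = F + 2 * Suc s" "m 16 = t" "m 9 = m1 9"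
          using m eqs1 eqs2 frame by (auto simp: Q_def t_def)
        have acc: "int (m1 9) = signed_sum k s mod int (Suc p)"
          using m1 by (simp add: I_def)
        then have "int (m1 9) < int (Suc p)"
          by simp
        then have "m1 9 \<le> p"
          by simp
        moreover have "t < Suc p"
          by (simp add: t_def)
        moreover have "2 * p < 2 ^ w"
          using w_products p(2) by (simp add: algebra_simps)
        ultimately have safe_add: "m1 9 + t < 2 ^ w"
          by linarith
        moreover have "(m1 9 + t) div Suc p * Suc p \<le> m1 9 + t"
          by (rule div_times_less_eq_dividend)
        ultimately have safe_mult: "(m1 9 + t) div Suc p * Suc p < 2 ^ w"
          by linarith
        have "int c mod int (Suc p) = (-1) ^ h mod int (Suc p)"
        proof (cases "odd h")
          case True
          have "int p mod int (Suc p) = (-1 + int (Suc p)) mod int (Suc p)"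
            by simp
          also have "\<dots> = -1 mod int (Suc p)"
            by (rule mod_add_self2)
          finally show ?thesis
            using True by (simp add: c_def)
        qed (simp add: c_def)
        then have "int t = (-1) ^ h * int x ^ k mod int (Suc p)"
          unfolding t_def of_nat_mod of_nat_mult of_nat_power
          by (metis mod_mult_cong mod_mod_trivial power_mod)
        then have "int ((m1 9 + t) mod Suc p) = signed_sum k (Suc s) mod int (Suc p)"
          unfolding of_nat_mod of_nat_add acc by (simp add: mod_add_eq signed_sum_def h_def x_def)
        moreover have "all_safe w term_add m"
          by (simp add: term_add_def eqs safe_add safe_mult del: mult_Suc_right)
        ultimately show "all_safe w term_add m \<and> I (Suc s) (effects term_add m)"
          using m1 by (simp add: I_def term_add_def eqs frame minus_div_mult_eq_mod del: mult_Suc_right)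
      qed (simp_all add: w_ge term_add_def)
      ultimately show "triple w (\<lambda>m. m = m1) sum_body (11 + ((k * (5 + 2) + 1) + 5)) (I (Suc s))"
        unfolding sum_body_def by (intro triple_Seq)
    qed
  qed (auto simp: I_def w_ge)
  moreover have "I 0 m0"
    using m0 by (simp add: I_def signed_sum_def)
  ultimately show ?thesis
    by (elim triple_conseq) (auto simp: I_def)
qed

lemma modulus_loop:
  assumes m0: "m0 2 = 1" "m0 3 = k" "m0 4 = 1" "m0 5 = 2 * (n * n) + 2" "m0 7 = F" "m0 10 = 2 ^ n"
      "table_ok (2 ^ n) m0"
  shows "triple w (\<lambda>m. m = m0) (While 5 modulus_body)
    ((2 * (n * n) + 2) * ((4 + ((2 ^ n * ((11 + ((k * (5 + 2) + 1) + 5)) + 2) + 1) + 2)) + 2) + 1)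
    (\<lambda>m. (\<forall>b. b \<notin> {4, 5, 8, 9, 11, 12, 13, 14, 15, 16, 17} \<longrightarrow> m b = m0 b) \<and>
         m 4 = of_bool (\<forall>i<2 * (n * n) + 2. signed_sum k (2 ^ n) mod int (2 * (n * n) + 2 + 1 - i) = 0))"
proof -
  define L where "L = 2 * (n * n) + 2"
  define I where "I j m \<longleftrightarrow> (\<forall>b. b \<notin> {4, 5, 8, 9, 11, 12, 13, 14, 15, 16, 17} \<longrightarrow> m b = m0 b) \<and>
      m 5 = L - j \<and> m 4 = of_bool (\<forall>i<j. signed_sum k (2 ^ n) mod int (L + 1 - i) = 0)"
    for j and m :: memory
  have "triple w (I 0) (While 5 modulus_body)
    (L * ((4 + ((2 ^ n * ((11 + ((k * (5 + 2) + 1) + 5)) + 2) + 1) + 2)) + 2) + 1) (I L)"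
  proof (rule triple_While)
    fix j assume j: "j < L"
    show "triple w (I j) modulus_body
        (4 + ((2 ^ n * ((11 + ((k * (5 + 2) + 1) + 5)) + 2) + 1) + 2)) (I (Suc j))"
    proof (rule triple_fix_state)
      fix m1 assume "fits w m1" and m1: "I j m1"
      define m2 where "m2 = effects modulus_init m1"
      have eqs1: "m1 2 = 1" "m1 3 = k" "m1 5 = L - j" "m1 7 = F" "m1 10 = 2 ^ n"
        using m1 m0 by (auto simp: I_def)
      have frame2: "m2 b = m1 b" if "b \<notin> {8, 9, 11, 12}" for b
        using that by (auto simp: m2_def modulus_init_def)
      have tab2: "table_ok (2 ^ n) m2"
        using m0(7) by (rule table_ok_cong) (use m1 F_ge frame2 in \<open>simp add: I_def\<close>)
      define Q where "Q m \<longleftrightarrow> (\<forall>b. b \<notin> {9, 11, 12, 13, 14, 15, 16, 17} \<longrightarrow> m b = m2 b) \<and>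
         int (m 9) = signed_sum k (2 ^ n) mod int (Suc (L - j))" for m
      have "triple w (\<lambda>m. m = m1) (Block modulus_init) 4 (\<lambda>m. m = m2)"
      proof (rule triple_Block)
        fix m assume "m = m1"
        moreover have "Suc (L - j) < 2 ^ w"
          using w_products by (simp add: L_def algebra_simps)
        ultimately show "all_safe w modulus_init m \<and> effects modulus_init m = m2"
          by (simp add: m2_def modulus_init_def eqs1)
      qed (simp_all add: w_ge modulus_init_def)
      moreover have "triple w (\<lambda>m. m = m2) (While 11 sum_body)
          (2 ^ n * ((11 + ((k * (5 + 2) + 1) + 5)) + 2) + 1) Q"
        unfolding Q_def using j tab2
        by (intro sum_loop) (auto simp: L_def m2_def modulus_init_def eqs1)
      moreover have "triple w Q (Block modulus_next) 2 (I (Suc j))"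
      proof (rule triple_Block)
        fix m assume "fits w m" and m: "Q m"
        have frame: "m b = m1 b" if "b \<notin> {8, 9, 11, 12, 13, 14, 15, 16, 17}" for b
          using that m frame2 by (auto simp: Q_def)
        have eqs: "m 2 = 1" "m 5 = L - j" "m 4 = m1 4"
          using eqs1 frame by auto
        have m9: "m 9 = 0 \<longleftrightarrow> signed_sum k (2 ^ n) mod int (L + 1 - j) = 0"
          using m j by (auto simp: Q_def Suc_diff_le simp flip: of_nat_eq_0_iff [where 'a = int])
        have "m1 4 - m 9 = of_bool (\<forall>i<Suc j. signed_sum k (2 ^ n) mod int (L + 1 - i) = 0)"
        proof -
          have "m1 4 = of_bool (\<forall>i<j. signed_sum k (2 ^ n) mod int (L + 1 - i) = 0)"
            using m1 by (simp add: I_def)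
          then show ?thesis
            unfolding All_less_Suc m9 [symmetric] by (cases "m 9") auto
        qed
        moreover have "all_safe w modulus_next m"
          by (simp add: modulus_next_def)
        ultimately show "all_safe w modulus_next m \<and> I (Suc j) (effects modulus_next m)"
          using m1 by (simp add: I_def modulus_next_def eqs frame)
      qed (simp_all add: w_ge modulus_next_def)
      ultimately show "triple w (\<lambda>m. m = m1) modulus_body
          (4 + ((2 ^ n * ((11 + ((k * (5 + 2) + 1) + 5)) + 2) + 1) + 2)) (I (Suc j))"
        unfolding modulus_body_def by (intro triple_Seq)
    qed
  qed (auto simp: I_def w_ge)
  moreover have "I 0 m0"
    using m0 by (simp add: I_def L_def)
  ultimately show ?thesis
    unfolding L_def [symmetric] by (elim triple_conseq) (auto simp: I_def)
qed

section \<open>The search for the least number of colours\<close>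

text \<open>The flag for \<open>j\<close> is nonzero exactly while \<open>j\<close> is below the
  chromatic number, so the number of rounds is the result.\<close>

lemma search:
  "triple w (\<lambda>m. m 0 = n \<and> m 2 = 1 \<and> m 7 = F \<and> m 10 = 2 ^ n \<and> m 24 = 2 \<and> table_ok (2 ^ n) m) search
     (2 + ((n * ((5 + ((2 * (n * n) + 2) * (2 ^ n * (7 * n + 19) + 9) + 1)) + 2) + 1) + 1))
     (\<lambda>m. m 0 = chromatic_number {..<n} E)"
proof -
  define I where "I j m \<longleftrightarrow> m 0 = n \<and> m 2 = 1 \<and> m 7 = F \<and> m 10 = 2 ^ n \<and> m 24 = 2 \<and>
      table_ok (2 ^ n) m \<and> m 3 = j \<and> (m 4 \<noteq> 0 \<longleftrightarrow> j < chromatic_number {..<n} E)" for j and m :: memory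
  have "0 < n \<longleftrightarrow> 0 < chromatic_number {..<n} E"
  proof
    assume "0 < n"
    then have "num_covers E 0 {..<n} = 0"
      by (auto simp: num_covers_def)
    then show "0 < chromatic_number {..<n} E"
      using num_covers_pos_iff [OF graph, of 0] by auto
  next
    assume "0 < chromatic_number {..<n} E"
    then show "0 < n"
      using chromatic_number_le_card [OF graph] by simp
  qed
  moreover have "table_ok (2 ^ n) (m(3 := 0, 4 := n))" if "table_ok (2 ^ n) m" for m
    using that by (rule table_ok_cong) (use F_ge in simp)
  ultimately have "triple w (\<lambda>m. m 0 = n \<and> m 2 = 1 \<and> m 7 = F \<and> m 10 = 2 ^ n \<and> m 24 = 2 \<and> table_ok (2 ^ n) m)
      (Block search_init) 2 (I 0)"
    by (intro triple_Block) (simp_all add: I_def search_init_def w_ge)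
  moreover have "triple w (I 0) (While 4 (Block search_next ;; While 5 modulus_body))
      (n * ((5 + ((2 * (n * n) + 2) * (2 ^ n * (7 * n + 19) + 9) + 1)) + 2) + 1)
      (I (chromatic_number {..<n} E))"
  proof (rule triple_conseq [OF triple_While])
    fix j assume j: "j < chromatic_number {..<n} E"
    then have k: "Suc j \<le> n"
      using chromatic_number_le_card [OF graph] by simp
    show "triple w (I j) (Block search_next ;; While 5 modulus_body)
        (5 + ((2 * (n * n) + 2) * (2 ^ n * (7 * n + 19) + 9) + 1)) (I (Suc j))"
    proof (rule triple_fix_state)
      fix m1 assume "fits w m1" and m1: "I j m1"
      define m2 where "m2 = effects search_next m1"
      have eqs1: "m1 0 = n" "m1 2 = 1" "m1 3 = j" "m1 7 = F" "m1 10 = 2 ^ n" "m1 24 = 2"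
        and tab1: "table_ok (2 ^ n) m1"
        using m1 by (auto simp: I_def)
      have frame2: "m2 b = m1 b" if "b \<notin> {3, 4, 5}" for b
        using that by (auto simp: m2_def search_next_def)
      have tab2: "table_ok (2 ^ n) m2"
        using tab1 by (rule table_ok_cong) (use F_ge frame2 in simp)
      have "triple w (\<lambda>m. m = m1) (Block search_next) 5 (\<lambda>m. m = m2)"
      proof (rule triple_Block)
        fix m assume "m = m1"
        moreover have "Suc j < 2 ^ w"
          using w_F k less_exp [of n] by linarith
        moreover have "n * n < 2 ^ w" "n * n + n * n < 2 ^ w" "Suc (Suc (n * n + n * n)) < 2 ^ w"
          using w_addresses by simp_all
        ultimately show "all_safe w search_next m \<and> effects search_next m = m2"
          by (simp add: m2_def search_next_def eqs1)
      qed (simp_all add: w_ge search_next_def)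
      moreover have "triple w (\<lambda>m. m = m2) (While 5 modulus_body)
          ((2 * (n * n) + 2) * (2 ^ n * (7 * n + 19) + 9) + 1) (I (Suc j))"
      proof (rule triple_conseq [OF modulus_loop [where k = "Suc j"]])
        show "m2 2 = 1" "m2 3 = Suc j" "m2 4 = 1" "m2 5 = 2 * (n * n) + 2" "m2 7 = F" "m2 10 = 2 ^ n"
          by (simp_all add: m2_def search_next_def eqs1)
        \<comment> \<open>The inner cost is \<open>7 * k + 19\<close> per table entry with
          \<open>k = Suc j\<close>, and \<open>k\<close> is at most \<open>n\<close>.\<close>
        have "(2::nat) ^ n * (11 + (Suc j * (5 + 2) + 1 + 5) + 2) \<le> 2 ^ n * (7 * n + 19)"
          using k by (intro mult_left_mono) simp_all
        then show "(2 * (n * n) + 2) *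
            (4 + (2 ^ n * (11 + (Suc j * (5 + 2) + 1 + 5) + 2) + 1 + 2) + 2) + 1
            \<le> (2 * (n * n) + 2) * (2 ^ n * (7 * n + 19) + 9) + 1"
          by (intro add_right_mono mult_left_mono) simp_all
        show "table_ok (2 ^ n) m2"
          by (fact tab2)
        fix m assume m: "(\<forall>b. b \<notin> {4, 5, 8, 9, 11, 12, 13, 14, 15, 16, 17} \<longrightarrow> m b = m2 b) \<and>
          m 4 = of_bool (\<forall>i<2 * (n * n) + 2.
            signed_sum (Suc j) (2 ^ n) mod int (2 * (n * n) + 2 + 1 - i) = 0)"
        have tab: "table_ok (2 ^ n) m"
          using tab2 by (rule table_ok_cong) (use F_ge m in simp)
        have "m 4 \<noteq> 0 \<longleftrightarrow> Suc j < chromatic_number {..<n} E"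
          using m all_moduli_iff [OF k] by simp
        moreover have "m 0 = n" "m 2 = 1" "m 7 = F" "m 10 = 2 ^ n" "m 24 = 2" "m 3 = Suc j"
          using m by (simp_all add: m2_def search_next_def eqs1)
        ultimately show "I (Suc j) m"
          using tab by (simp add: I_def)
      qed simp
      ultimately show "triple w (\<lambda>m. m = m1) (Block search_next ;; While 5 modulus_body)
          (5 + ((2 * (n * n) + 2) * (2 ^ n * (7 * n + 19) + 9) + 1)) (I (Suc j))"
        by (rule triple_Seq)
    qed
  next
    show "chromatic_number {..<n} E * ((5 + ((2 * (n * n) + 2) * (2 ^ n * (7 * n + 19) + 9) + 1)) + 2) + 1
        \<le> n * ((5 + ((2 * (n * n) + 2) * (2 ^ n * (7 * n + 19) + 9) + 1)) + 2) + 1"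
      using chromatic_number_le_card [OF graph] by (intro add_right_mono mult_right_mono) simp_all
  qed (auto simp: I_def w_ge)
  moreover have "triple w (I (chromatic_number {..<n} E)) (Block [Move 0 3]) 1
      (\<lambda>m. m 0 = chromatic_number {..<n} E)"
    by (intro triple_Block) (auto simp: I_def w_ge)
  ultimately show ?thesis
    unfolding search_def by (intro triple_Seq)
qed

lemma chromatic_com_correct:
  "computes_within (compile 0 chromatic_com) (graph_input n E) (chromatic_number {..<n} E)
     (time_bound n) (2 ^ w) w"
proof -
  let ?m = "snd (initial_config (graph_input n E))"
  have len: "length (graph_input n E) = Suc (n * n)"
    by (simp add: graph_input_def)
  have m: "?m a = (if a \<le> n * n then graph_input n E ! a else 0)" for a
    by (simp add: initial_config_def len)
  have "n + 1 < 2 ^ w"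
    using w_F less_exp [of n] by linarith
  then have "fits w ?m"
    using graph_input_le [of _ n E] by (auto simp: fits_def m len intro: le_less_trans)
  moreover have "?m 0 = n"
    by (simp add: m) (simp add: graph_input_def)
  moreover have "triple w (\<lambda>m'. m' 0 = n \<and> (\<forall>i. 3 \<le> i \<and> i \<le> n * n \<longrightarrow> m' i = ?m i)) chromatic_com
      (time_bound n) (\<lambda>m'. m' 0 = chromatic_number {..<n} E)"
    unfolding chromatic_com_def time_bound_def
  proof (intro triple_Seq)
    show "triple w (\<lambda>m'. m' 0 = n \<and> (\<forall>i. 3 \<le> i \<and> i \<le> n * n \<longrightarrow> m' i = ?m i)) relocate
        (48 + (4 + ((n * n * (5 + 2) + 1) + 4)))
        (\<lambda>m. m 0 = n \<and> m 2 = 1 \<and> m 6 = D + 1 \<and> m 7 = F \<and> adj_ok m)"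
    proof (rule relocate)
      fix v u assume v: "v < n" "u < v"
      show "?m (1 + v * n + u) = of_bool ({v, u} \<in> E)"
        unfolding m using row_less [of v n u] nth_graph_input [of v n u E] v by simp
    qed
  qed (rule make_table search)+
  ultimately obtain t m' where t: "t \<le> time_bound n" "m' 0 = chromatic_number {..<n} E"
      "reaches (compile 0 chromatic_com) w (0, ?m) t (csize chromatic_com, m')"
    using triple_compile by blast
  have init: "(0, ?m) = initial_config (graph_input n E)"
    by (simp add: initial_config_def)
  have "length (graph_input n E) \<le> 2 ^ w"
    using w_addresses by (simp add: len)
  then show ?thesis
    using t by (intro reaches_imp_computes_within [OF t(3) [unfolded init]]) (simp_all add: halted_def)
qed

end

section \<open>Word length and asymptotics\<close>

text \<open>The shift by 8 makes the induction work from 0: \<open>8 ^ 4 = 2 ^ 12\<close>, and each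
  step multiplies the left side by at most \<open>(9 / 8) ^ 4 < 2\<close>.\<close>

lemma shifted_fourth_power_le: "(n + 8) ^ 4 \<le> (2 :: nat) ^ (n + 12)"
proof (induction n)
  case (Suc n)
  have "(8 * (n + 9)) ^ 4 \<le> (9 * (n + 8)) ^ 4"
    by (intro power_mono) simp_all
  then have "(n + 9) ^ 4 \<le> 2 * (n + 8) ^ 4"
    unfolding power_mult_distrib by simp
  also have "\<dots> \<le> 2 * 2 ^ (n + 12)"
    using Suc by simp
  also have "\<dots> = 2 ^ (Suc n + 12)"
    by (simp only: add_Suc power_Suc)
  also have "n + 9 = Suc n + 8"
    by simp
  finally show ?case .
qed simp

text \<open>Products stay within \<open>4 * 2 ^ (n + 12) = 2 ^ (n + 14)\<close> and addresses below
  \<open>(8192 + 4 + 300) * 2 ^ n + 1\<close>; 16 extra bits cover both.\<close>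

lemma graph_machine_exists:
  assumes "simple_graph {..<n} E"
  shows "graph_machine n (n + 16) E"
proof
  have sq: "2 * (n * n) + 3 \<le> 2 * ((n + 8) * (n + 8))"
    by (simp add: algebra_simps)
  then have "(2 * (n * n) + 3) * (2 * (n * n) + 3) \<le> (2 * ((n + 8) * (n + 8))) * (2 * ((n + 8) * (n + 8)))"
    by (rule mult_le_mono [OF _ sq])
  also have "\<dots> = 4 * (n + 8) ^ 4"
    by (simp add: power4_eq_xxxx mult_ac)
  also have "\<dots> \<le> 4 * 2 ^ (n + 12)"
    using shifted_fourth_power_le by simp
  also have "\<dots> < 2 ^ (n + 16)"
    by (simp add: power_add)
  finally show "(2 * (n * n) + 3) * (2 * (n * n) + 3) < (2 :: nat) ^ (n + 16)" .
  have "2 * (n * n) \<le> 2 * (n * n) + 3"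
    by simp
  also note sq
  also have "2 * ((n + 8) * (n + 8)) \<le> 2 * ((n + 8) * (n + 8)) * ((n + 8) * (n + 8))"
    by simp
  also have "\<dots> = 2 * (n + 8) ^ 4"
    by (simp add: power4_eq_xxxx mult_ac)
  also have "\<dots> \<le> 2 * 2 ^ (n + 12)"
    using shifted_fourth_power_le by simp
  finally have "2 * (n * n) \<le> 8192 * 2 ^ n"
    by (simp add: power_add)
  moreover have "1 \<le> (2 :: nat) ^ n"
    by simp
  ultimately have "2 * (n * n) + 4 * 2 ^ n + 300 < 65536 * (2 :: nat) ^ n"
    by linarith
  then show "2 * (n * n) + 4 * 2 ^ n + 300 < (2 :: nat) ^ (n + 16)"
    by (simp add: power_add)
qed (rule assms)

lemma time_bound_bigo: "(\<lambda>n. real (time_bound n)) \<in> O(\<lambda>n. (4 / 3 + 3 powr (4 / 3) / 4) ^ n)"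
proof -
  \<comment> \<open>A rational base strictly above 2 absorbs the polynomial factor;
    \<open>25 / 12\<close> is \<open>4 / 3 + 3 / 4\<close>.\<close>
  have "(\<lambda>n. real (time_bound n)) \<in> O(\<lambda>n. (25 / 12) ^ n)"
    unfolding time_bound_def of_nat_add of_nat_mult of_nat_power of_nat_numeral of_nat_1 by real_asymp
  also have "(\<lambda>n. (25 / 12) ^ n) \<in> O(\<lambda>n. (4 / 3 + 3 powr (4 / 3) / 4 :: real) ^ n)"
  proof (rule bigoI [of _ 1], rule always_eventually, rule allI)
    fix n :: nat
    have "(3 :: real) powr 1 \<le> 3 powr (4 / 3)"
      by (intro powr_mono) auto
    then have "(25 / 12 :: real) ^ n \<le> (4 / 3 + 3 powr (4 / 3) / 4) ^ n"
      by (intro power_mono) auto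
    then show "norm ((25 / 12 :: real) ^ n) \<le> 1 * norm ((4 / 3 + 3 powr (4 / 3) / 4 :: real) ^ n)"
      by simp
  qed
  finally show ?thesis .
qed

theorem theorem6:
  "\<exists>(P :: program) (T :: nat \<Rightarrow> nat) (M :: nat \<Rightarrow> nat) (d :: nat).
     (\<lambda>n. real (T n)) \<in> O(\<lambda>n. (4 / 3 + 3 powr (4 / 3) / 4) ^ n) \<and>
     (\<lambda>n. real (M n)) \<in> O(\<lambda>n. 2 ^ n) \<and>
     (\<forall>n E. simple_graph {..<n} E \<longrightarrow>
        computes_within P (graph_input n E) (chromatic_number {..<n} E) (T n) (M n) (n + d))"
proof (intro exI conjI allI impI)
  show "(\<lambda>n. real (time_bound n)) \<in> O(\<lambda>n. (4 / 3 + 3 powr (4 / 3) / 4) ^ n)"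
    by (rule time_bound_bigo)
  \<comment> \<open>The memory is the full address space of a word, only a constant factor above
    \<open>2 ^ n\<close>.\<close>
  show "(\<lambda>n. real (2 ^ (n + 16))) \<in> O(\<lambda>n. 2 ^ n)"
    by (simp add: power_add)
  fix n :: nat and E assume "simple_graph {..<n} E"
  then show "computes_within (compile 0 chromatic_com) (graph_input n E) (chromatic_number {..<n} E)
      (time_bound n) (2 ^ (n + 16)) (n + 16)"
    by (intro graph_machine.chromatic_com_correct graph_machine_exists)
qed

end
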